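(* Let $k\geq 2$ be an integer, let $\vec{s}=(s_1,\ldots,s_{k-1},1)$ be an integer vector with $s_i\geq 2$ for $1\leq i\leq k-1$, and let $n\geq\sum_{i=1}^{k-1}s_i+2$. Then the poset $P(n,k,\vec{s})$ is homotopy equivalent to the sphere $\mathbb{S}^{\,n-\sum_{i=1}^{k-1}s_i-2}$ (i.e. its order complex is). In particular, $P(n,k,\vec{s})$ is $\left(n-\sum_{i=1}^{k-1}s_i-3\right)$-connected.
   Context: $[n]=\{1,\ldots,n\}$. For a $k$-subset $A\subseteq[n]$ let $A(1)<\cdots<A(k)$ be its elements in increasing order. Given an integer vector $\vec{s}=(s_1,\ldots,s_k)$, a $k$-subset $A\subseteq[n]$ is called $\vec{s}$-stable if $s_j\leq A(j+1)-A(j)$ for all $1\leq j\leq k-1$ and $A(k)-A(1)\leq n-s_k$. $P(n,k,\vec{s})$ is the poset whose elements are the pairs $(A,B)$ of subsets of $[n]$ with $A\cap B=\emptyset$ such that each of $A$ and $B$ contains an $\vec{s}$-stable $k$-subset, ordered by $(A_1,B_1)\leq(A_2,B_2)$ iff $A_1\subseteq A_2$ and $B_1\subseteq B_2$. A poset is said to be homotopy equivalent to a space (or to be $m$-connected) if its order complex $\Delta(P)$ (the simplicial complex of chains of $P$) is. *)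

theory Defs
  imports "HOL-Analysis.Analysis"
begin

(* A(j) for j = 1, ..., card A *)
definition elem_at :: "nat set \<Rightarrow> nat \<Rightarrow> nat" where
  "elem_at A j = sorted_list_of_set A ! (j - 1)"

(* The vector (s_1, ..., s_k) is a function of which only the values at 1, ..., k are used.
   Differences are taken in int, where subtraction does not truncate. *)
definition stable_subset :: "nat \<Rightarrow> nat \<Rightarrow> (nat \<Rightarrow> int) \<Rightarrow> nat set \<Rightarrow> bool" where
  "stable_subset n k s A \<longleftrightarrow>
     A \<subseteq> {1..n} \<and> card A = k \<and>
     (\<forall>j\<in>{1..k-1}. s j \<le> int (elem_at A (j + 1)) - int (elem_at A j)) \<and>
     int (elem_at A k) - int (elem_at A 1) \<le> int n - s k"

(* The elements are ordered by \<le> on pairs of sets, i.e. by componentwise inclusion. *)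
definition stable_pairs :: "nat \<Rightarrow> nat \<Rightarrow> (nat \<Rightarrow> int) \<Rightarrow> (nat set \<times> nat set) set" where
  "stable_pairs n k s =
     {(A, B). A \<subseteq> {1..n} \<and> B \<subseteq> {1..n} \<and> A \<inter> B = {} \<and>
              (\<exists>C\<subseteq>A. stable_subset n k s C) \<and> (\<exists>D\<subseteq>B. stable_subset n k s D)}"

lemma stable_pairs_order:
  fixes A\<^sub>1 A\<^sub>2 B\<^sub>1 B\<^sub>2 :: "nat set"
  shows "(A\<^sub>1, B\<^sub>1) \<le> (A\<^sub>2, B\<^sub>2) \<longleftrightarrow> A\<^sub>1 \<subseteq> A\<^sub>2 \<and> B\<^sub>1 \<subseteq> B\<^sub>2"
  by simp

definition order_complex :: "'a::order set \<Rightarrow> 'a set set" where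
  "order_complex P = {C. finite C \<and> C \<subseteq> P \<and> Complete_Partial_Order.chain (\<le>) C}"

(* Points are barycentric coordinates on the vertex set \<Union>K. The topology is that of pointwise
   convergence of coordinates; on a finite complex it is the usual (weak) topology. *)
definition geometric_realization :: "'a set set \<Rightarrow> ('a \<Rightarrow> real) topology" where
  "geometric_realization K =
     subtopology (powertop_real (\<Union>K))
       {x. (\<forall>v\<in>\<Union>K. 0 \<le> x v) \<and> {v \<in> \<Union>K. x v \<noteq> 0} \<in> K \<and>
           (\<Sum>v | v \<in> \<Union>K \<and> x v \<noteq> 0. x v) = 1}"

(* (-1)-connected means nonempty, and nothing is required for m < -1. *)
definition connected_upto :: "int \<Rightarrow> 'a topology \<Rightarrow> bool" where
  "connected_upto m X \<longleftrightarrow>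
     (-1 \<le> m \<longrightarrow> topspace X \<noteq> {}) \<and>
     (\<forall>i::nat. int i \<le> m \<longrightarrow>
        (\<forall>f. continuous_map (nsphere i) X f \<longrightarrow>
           (\<exists>c. homotopic_with (\<lambda>_. True) (nsphere i) X f (\<lambda>_. c))))"

end

theory Submission
  imports Defs
begin

text \<open>
  Order complexes are flag complexes, so the homotopy type may be computed by deleting dominated
  vertices and edges, each deletion being a straight-line retraction. Let \<open>P n\<close> be the poset on
  \<open>{1..n}\<close>, and let \<open>Q\<^sub>A\<close> (resp. \<open>Q\<^sub>B\<close>) consist of the pairs \<open>(A, B)\<close> for which \<open>B - {n}\<close>
  (resp. \<open>A - {n}\<close>) still contains a stable \<open>k\<close>-subset. As \<open>n\<close> lies in at most one of \<open>A\<close>, \<open>B\<close>,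
  these two up-sets cover \<open>P n\<close>, and \<open>Q\<^sub>A \<inter> Q\<^sub>B\<close> retracts to \<open>P (n - 1)\<close>. Each of the
  two up-sets is contractible: one can alternately add the largest admissible point to \<open>A\<close> or \<open>B\<close> and then discard everything that is too
  close to it; here \<open>s i \<ge> 2\<close> keeps the two points that are being added distinct. Hence \<open>P n\<close> is
  a suspension of \<open>P (n - 1)\<close>. The poset is empty for \<open>n = s 1 + \<dots> + s (k - 1) + 1\<close>, so what remains
  after all the suspensions is the boundary of a cross-polytope.

  A map from a sphere to a higher-dimensional one is null-homotopic, because a Lipschitz approximation
  of a continuous extension to the ball misses some point near the origin, by counting grid points.
\<close>

section \<open>Flag complexes\<close>

lemma homotopic_with_segments:
  fixes f g :: "'b::topological_space \<Rightarrow> 'a \<Rightarrow> real"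
  assumes "continuous_on X f" "continuous_on X g"
    and seg: "\<And>x t. x \<in> X \<Longrightarrow> 0 \<le> t \<Longrightarrow> t \<le> 1 \<Longrightarrow> (\<lambda>v. (1 - t) * f x v + t * g x v) \<in> S"
  shows "homotopic_with_canon (\<lambda>_. True) X S f g"
  unfolding homotopic_with_def
proof (intro exI conjI allI ballI)
  let ?h = "\<lambda>p v. (1 - fst p) * f (snd p) v + fst p * g (snd p) v"
  have c: "continuous_on X (\<lambda>x. f x v)" "continuous_on X (\<lambda>x. g x v)" for v
    using assms(1,2) by (auto intro: continuous_on_product_then_coordinatewise)
  have "continuous_on ({0..1} \<times> X) (\<lambda>p. f (snd p) v)" "continuous_on ({0..1} \<times> X) (\<lambda>p. g (snd p) v)" for v
    by (rule continuous_on_compose2[OF c(1)] continuous_on_compose2[OF c(2)],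
        auto intro: continuous_intros)+
  then have "continuous_on ({0..1} \<times> X) ?h"
    by (intro continuous_on_coordinatewise_then_product continuous_intros)
  moreover have "?h ` ({0..1} \<times> X) \<subseteq> S"
    using seg by auto
  ultimately show "continuous_map (prod_topology (top_of_set {0..1}) (top_of_set X)) (top_of_set S) ?h"
    by (simp add: prod_topology_subtopology_eu image_subset_iff_funcset)
qed auto

lemma deformation_by_segments:
  fixes S T :: "('a \<Rightarrow> real) set"
  assumes "T \<subseteq> S" "continuous_on S r" "\<And>x. x \<in> S \<Longrightarrow> r x \<in> T" "\<And>x. x \<in> T \<Longrightarrow> r x = x"
    and seg: "\<And>x t. x \<in> S \<Longrightarrow> 0 \<le> t \<Longrightarrow> t \<le> 1 \<Longrightarrow> (\<lambda>v. (1 - t) * r x v + t * x v) \<in> S"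
  shows "top_of_set S homotopy_equivalent_space top_of_set T"
proof (rule deformation_retraction_imp_homotopy_equivalent_space)
  have "homotopic_with_canon (\<lambda>_. True) S S r (\<lambda>x. x)"
    by (rule homotopic_with_segments) (use assms in \<open>auto intro: continuous_on_id\<close>)
  then show "homotopic_with (\<lambda>x. True) (top_of_set S) (top_of_set S) (id \<circ> r) id"
    by (simp add: id_def o_def)
  show "retraction_maps (top_of_set S) (top_of_set T) r id"
    using assms by (auto simp: retraction_maps_def id_def continuous_on_id)
qed

text \<open>Barycentric coordinates on the clique complex of \<open>R\<close>. The functions live on
  the whole type and vanish off \<open>V\<close>, so that the spaces for different \<open>V\<close>
  and \<open>R\<close> are nested in one function space and a retraction is a self-map of the larger
  one.\<close>

definition flag_real :: "('a \<Rightarrow> 'a \<Rightarrow> bool) \<Rightarrow> 'a set \<Rightarrow> ('a \<Rightarrow> real) set" where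
  "flag_real R V = {x. (\<forall>v. 0 \<le> x v) \<and> (\<forall>v. v \<notin> V \<longrightarrow> x v = 0) \<and> sum x V = 1 \<and>
                       (\<forall>u v. x u \<noteq> 0 \<longrightarrow> x v \<noteq> 0 \<longrightarrow> R u v)}"

lemma flag_real_cong:
  assumes "\<And>u v. u \<in> V \<Longrightarrow> v \<in> V \<Longrightarrow> R u v = R' u v"
  shows "flag_real R V = flag_real R' V"
proof -
  have "(\<forall>u v. x u \<noteq> 0 \<longrightarrow> x v \<noteq> 0 \<longrightarrow> R u v) \<longleftrightarrow> (\<forall>u v. x u \<noteq> 0 \<longrightarrow> x v \<noteq> 0 \<longrightarrow> R' u v)"
    if "\<forall>v. v \<notin> V \<longrightarrow> x v = 0" for x :: "'a \<Rightarrow> real"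
    using that assms by metis
  then show ?thesis
    unfolding flag_real_def by (auto cong: conj_cong)
qed

text \<open>The support of a convex combination lies in the union of the two supports, and the mixed
  condition makes this union a clique.\<close>

lemma flag_real_segment:
  assumes "x \<in> flag_real R V" "y \<in> flag_real R V" "0 \<le> t" "t \<le> (1::real)"
    and "\<And>u v. x u \<noteq> 0 \<Longrightarrow> y v \<noteq> 0 \<Longrightarrow> R u v \<and> R v u"
  shows "(\<lambda>v. (1 - t) * x v + t * y v) \<in> flag_real R V"
proof -
  have "R u v" if "(1 - t) * x u + t * y u \<noteq> 0" "(1 - t) * x v + t * y v \<noteq> 0" for u v
  proof -
    have "x u \<noteq> 0 \<or> y u \<noteq> 0" "x v \<noteq> 0 \<or> y v \<noteq> 0"
      using that by auto
    then show ?thesis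
      using assms unfolding flag_real_def by blast
  qed
  moreover have "(\<Sum>v\<in>V. (1 - t) * x v + t * y v) = (1 - t) * sum x V + t * sum y V"
    by (simp add: sum.distrib sum_distrib_left)
  ultimately show ?thesis
    using assms(1-4) unfolding flag_real_def by simp
qed

lemma flag_real_subset:
  assumes "V' \<subseteq> V" "finite V" "\<And>u v. R' u v \<Longrightarrow> R u v"
  shows "flag_real R' V' \<subseteq> flag_real R V"
proof
  fix x assume x: "x \<in> flag_real R' V'"
  then have "sum x V = sum x V'"
    using assms by (intro sum.mono_neutral_right) (auto simp: flag_real_def)
  then show "x \<in> flag_real R V"
    using x assms unfolding flag_real_def by auto
qed

text \<open>All weight of \<open>v\<close> is moved to \<open>w\<close>. A clique containing
  \<open>v\<close> remains a clique when \<open>w\<close> is added, so a point and its image are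
  supported on a common clique and the segment between them stays inside.\<close>

lemma flag_real_remove_dominated:
  assumes "finite V" "symp R" "reflp R" "v \<in> V" "w \<in> V" "w \<noteq> v" "R v w"
    and dom: "\<And>y. y \<in> V \<Longrightarrow> R v y \<Longrightarrow> R w y"
  shows "top_of_set (flag_real R V) homotopy_equivalent_space top_of_set (flag_real R (V - {v}))"
proof -
  define r where "r x = (\<lambda>y. if y = v then 0 else if y = w then x w + x v else x y)" for x :: "'a \<Rightarrow> real"
  have sy: "R a b \<Longrightarrow> R b a" for a b using \<open>symp R\<close> by (rule sympD)
  have re: "R a a" for a using \<open>reflp R\<close> by (rule reflpD)
  have supp: "R a b" if x: "x \<in> flag_real R V" and "x a \<noteq> 0 \<or> r x a \<noteq> 0" "x b \<noteq> 0 \<or> r x b \<noteq> 0" for x a b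
  proof (cases "x v = 0")
    case True
    with that show ?thesis by (auto simp: r_def flag_real_def split: if_splits)
  next
    case False
    then have "R w c" if "x c \<noteq> 0" for c
      using x that dom[of c] unfolding flag_real_def by blast
    moreover have "x a \<noteq> 0 \<or> a = w" "x b \<noteq> 0 \<or> b = w"
      using that by (auto simp: r_def split: if_splits)
    ultimately show ?thesis
      using x sy re unfolding flag_real_def by blast
  qed
  have rT: "r x \<in> flag_real R (V - {v})" if x: "x \<in> flag_real R V" for x
  proof -
    have "sum (r x) (V - {v}) = r x w + sum (r x) (V - {v} - {w})"
      using assms by (subst sum.remove[of _ w]) auto
    also have "sum (r x) (V - {v} - {w}) = sum x (V - {v} - {w})"
      by (rule sum.cong) (auto simp: r_def)
    also have "r x w = x v + x w" using assms by (simp add: r_def)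
    also have "x v + x w + sum x (V - {v} - {w}) = sum x V"
      using assms by (simp add: sum.remove[of V v] sum.remove[of "V - {v}" w])
    finally have "sum (r x) (V - {v}) = 1" using x by (simp add: flag_real_def)
    moreover have "\<forall>u. 0 \<le> r x u" "\<forall>u. u \<notin> V - {v} \<longrightarrow> r x u = 0"
      using x assms by (auto simp: r_def flag_real_def)
    ultimately show ?thesis
      using supp[OF x] unfolding flag_real_def by blast
  qed
  have sub: "flag_real R (V - {v}) \<subseteq> flag_real R V"
    using assms by (intro flag_real_subset) auto
  show ?thesis
  proof (rule deformation_by_segments[of _ _ r])
    have "continuous_on (flag_real R V) (\<lambda>x. r x y)" for y
      unfolding r_def by (cases "y = v"; cases "y = w")
        (auto intro!: continuous_intros continuous_on_product_coordinates continuous_on_subset[OF continuous_on_product_coordinates])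
    then show "continuous_on (flag_real R V) r"
      by (rule continuous_on_coordinatewise_then_product)
    fix x assume x: "x \<in> flag_real R V"
    fix t :: real assume t: "0 \<le> t" "t \<le> 1"
    show "(\<lambda>v. (1 - t) * r x v + t * x v) \<in> flag_real R V"
      using x t rT[OF x] sub supp[OF x] by (intro flag_real_segment) blast+
  qed (use sub rT in \<open>auto simp: r_def flag_real_def fun_eq_iff\<close>)
qed

text \<open>The link of the edge is a cone with apex \<open>w\<close>. Taking the smaller of the two
  end weights off both ends and putting twice that amount on \<open>w\<close> makes one end vanish;
  only points whose support contains the edge are moved.\<close>

lemma flag_real_remove_edge:
  assumes "finite V" "symp R" "reflp R" "u \<in> V" "v \<in> V" "w \<in> V" "u \<noteq> v" "w \<noteq> u" "w \<noteq> v" "R u w" "R v w"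
    and dom: "\<And>y. y \<in> V \<Longrightarrow> R u y \<Longrightarrow> R v y \<Longrightarrow> R w y"
  shows "top_of_set (flag_real R V) homotopy_equivalent_space
         top_of_set (flag_real (\<lambda>a b. R a b \<and> {a, b} \<noteq> {u, v}) V)"
proof -
  let ?R = "\<lambda>a b. R a b \<and> {a, b} \<noteq> {u, v}"
  define r where "r x = (\<lambda>y. if y = u \<or> y = v then x y - min (x u) (x v)
      else if y = w then x w + 2 * min (x u) (x v) else x y)" for x :: "'a \<Rightarrow> real"
  have sy: "R a b \<Longrightarrow> R b a" for a b using \<open>symp R\<close> by (rule sympD)
  have re: "R a a" for a using \<open>reflp R\<close> by (rule reflpD)
  have supp: "R a b" if x: "x \<in> flag_real R V" and "x a \<noteq> 0 \<or> r x a \<noteq> 0" "x b \<noteq> 0 \<or> r x b \<noteq> 0" for x a b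
  proof (cases "x u = 0 \<or> x v = 0")
    case True
    then have "min (x u) (x v) = 0" using x by (auto simp: flag_real_def min_def order.antisym)
    then have "r x = x" by (auto simp: r_def)
    with that show ?thesis by (auto simp: flag_real_def)
  next
    case False
    then have "R w c" if "x c \<noteq> 0" for c
      using x that dom[of c] unfolding flag_real_def by blast
    moreover have "x a \<noteq> 0 \<or> a = w" "x b \<noteq> 0 \<or> b = w"
      using that False by (auto simp: r_def split: if_splits)
    ultimately show ?thesis
      using x sy re unfolding flag_real_def by blast
  qed
  have rT: "r x \<in> flag_real ?R V" if x: "x \<in> flag_real R V" for x
  proof -
    let ?W = "V - {u} - {v} - {w}"
    have split: "sum f V = f u + f v + f w + sum f ?W" for f :: "'a \<Rightarrow> real"
      using assms by (simp add: sum.remove[of V u] sum.remove[of "V - {u}" v] sum.remove[of "V - {u} - {v}" w])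
    have "sum (r x) ?W = sum x ?W"
      by (rule sum.cong) (auto simp: r_def)
    then have "sum (r x) V = sum x V"
      using assms by (simp add: split) (simp add: r_def)
    then have "sum (r x) V = 1" using x by (simp add: flag_real_def)
    moreover have "\<forall>y. 0 \<le> r x y" "\<forall>y. y \<notin> V \<longrightarrow> r x y = 0"
      using x assms by (auto simp: r_def flag_real_def min_def)
    moreover have "r x u = 0 \<or> r x v = 0"
      by (auto simp: r_def min_def)
    ultimately show ?thesis
      using supp[OF x] unfolding flag_real_def by (auto simp: doubleton_eq_iff)
  qed
  have sub: "flag_real ?R V \<subseteq> flag_real R V"
    using assms by (intro flag_real_subset) auto
  show ?thesis
  proof (rule deformation_by_segments[of _ _ r])
    have "continuous_on (flag_real R V) (\<lambda>x. r x y)" for y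
      unfolding r_def by (cases "y = u \<or> y = v"; cases "y = w")
        (auto intro!: continuous_intros continuous_on_subset[OF continuous_on_product_coordinates])
    then show "continuous_on (flag_real R V) r"
      by (rule continuous_on_coordinatewise_then_product)
    show "r x = x" if "x \<in> flag_real ?R V" for x
    proof -
      have "x u = 0 \<or> x v = 0" "0 \<le> x u" "0 \<le> x v"
        using that unfolding flag_real_def by auto
      then have "min (x u) (x v) = 0" by (auto simp: min_def)
      then show ?thesis by (auto simp: r_def)
    qed
    fix x assume x: "x \<in> flag_real R V"
    fix t :: real assume t: "0 \<le> t" "t \<le> 1"
    show "(\<lambda>v. (1 - t) * r x v + t * x v) \<in> flag_real R V"
      using x t rT[OF x] sub supp[OF x] by (intro flag_real_segment) blast+
  qed (use sub rT in auto)
qed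

section \<open>Strong collapses\<close>

text \<open>Dismantling by dominated vertices, kept as a combinatorial relation: unlike a homotopy
  equivalence it can be carried along injections, joined with further vertices, and replayed edge by
  edge in the neighbourhood of a vertex.\<close>

inductive strong_collapse :: "('a \<Rightarrow> 'a \<Rightarrow> bool) \<Rightarrow> 'a set \<Rightarrow> 'a set \<Rightarrow> bool" for R where
  refl: "strong_collapse R V V"
| step: "v \<in> V \<Longrightarrow> w \<in> V \<Longrightarrow> w \<noteq> v \<Longrightarrow> R v w \<Longrightarrow> (\<And>y. y \<in> V \<Longrightarrow> R v y \<Longrightarrow> R w y) \<Longrightarrow>
     strong_collapse R (V - {v}) V' \<Longrightarrow> strong_collapse R V V'"

lemma strong_collapse_trans:
  "strong_collapse R V V' \<Longrightarrow> strong_collapse R V' V'' \<Longrightarrow> strong_collapse R V V''"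
  by (induction rule: strong_collapse.induct) (auto intro: strong_collapse.step)

lemma strong_collapse_subset: "strong_collapse R V V' \<Longrightarrow> V' \<subseteq> V"
  by (induction rule: strong_collapse.induct) auto

lemma strong_collapse_cong:
  assumes "strong_collapse R V V'" "\<And>u v. u \<in> V \<Longrightarrow> v \<in> V \<Longrightarrow> R u v = R' u v"
  shows "strong_collapse R' V V'"
  using assms
proof (induction rule: strong_collapse.induct)
  case (step v V w V')
  show ?case
    by (rule strong_collapse.step[of v V w]) (use step in auto)
qed (rule strong_collapse.refl)

lemma strong_collapse_image:
  assumes "strong_collapse R V V'" "inj_on f V" "\<And>u v. u \<in> V \<Longrightarrow> v \<in> V \<Longrightarrow> R' (f u) (f v) = R u v"
  shows "strong_collapse R' (f ` V) (f ` V')"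
  using assms
proof (induction rule: strong_collapse.induct)
  case (step v V w V')
  have "f ` V - {f v} = f ` (V - {v})"
    using step by (simp add: inj_on_image_set_diff)
  moreover have "strong_collapse R' (f ` (V - {v})) (f ` V')"
    using step by (auto intro: inj_on_diff)
  moreover have "f w \<noteq> f v"
    using step by (meson inj_onD)
  ultimately show ?case
    using step by - (rule strong_collapse.step[of "f v" _ "f w"], auto)
qed (rule strong_collapse.refl)

text \<open>Every vertex of \<open>V\<close> is adjacent to all of \<open>U\<close>, so domination
  inside \<open>V\<close> persists when \<open>U\<close> is added.\<close>

lemma strong_collapse_join:
  assumes "strong_collapse R V V'" "V \<inter> U = {}" "\<And>u v. u \<in> U \<Longrightarrow> v \<in> V \<Longrightarrow> R v u"
  shows "strong_collapse R (V \<union> U) (V' \<union> U)"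
  using assms
proof (induction rule: strong_collapse.induct)
  case (step v V w V')
  then have "V \<union> U - {v} = V - {v} \<union> U"
    by auto
  moreover have "strong_collapse R (V - {v} \<union> U) (V' \<union> U)"
    by (rule step.IH) (use step.prems in auto)
  moreover have "R w y" if "y \<in> V \<union> U" "R v y" for y
    using that step.hyps(5) step.prems(2)[of y w] \<open>w \<in> V\<close> by blast
  ultimately show ?case
    using step.hyps(1-4) by - (rule strong_collapse.step[of v _ w], simp_all)
qed (rule strong_collapse.refl)

text \<open>The vertices of \<open>W\<close> are deleted in the order of increasing
  \<open>m\<close>. Neighbours of \<open>x\<close> in \<open>W\<close> with a smaller value are gone
  when the turn of \<open>x\<close> comes, so \<open>r x\<close> must be adjacent to the other
  neighbours only; it lies outside \<open>W\<close> and survives throughout.\<close>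

lemma strong_collapse_removal:
  fixes m :: "'a \<Rightarrow> nat"
  assumes "finite W" "W \<subseteq> V"
    and "\<And>x. x \<in> W \<Longrightarrow> r x \<in> V - W \<and> R x (r x)"
    and "\<And>x y. x \<in> W \<Longrightarrow> y \<in> V \<Longrightarrow> R x y \<Longrightarrow> R (r x) y \<or> (y \<in> W \<and> m y < m x)"
  shows "strong_collapse R V (V - W)"
  using assms
proof (induction "card W" arbitrary: V W)
  case 0
  then show ?case by (simp add: strong_collapse.refl)
next
  case (Suc n)
  then have "W \<noteq> {}" by auto
  then obtain x where x: "x \<in> W" "\<And>y. y \<in> W \<Longrightarrow> m x \<le> m y"
    using ex_min_if_finite[of "m ` W"] Suc.prems(1) by (force simp: not_less)
  have "strong_collapse R (V - {x}) ((V - {x}) - (W - {x}))"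
    using Suc.prems Suc.hyps(2) x by (intro Suc.hyps(1)) (auto simp: card_Diff_singleton)
  moreover have "(V - {x}) - (W - {x}) = V - W"
    using x by auto
  moreover have "R (r x) y" if "y \<in> V" "R x y" for y
    using Suc.prems(4)[OF x(1) that] x(2)[of y] by auto
  moreover have "x \<in> V" "r x \<in> V" "r x \<noteq> x" "R x (r x)"
    using Suc.prems(2) Suc.prems(3)[OF x(1)] x(1) by auto
  ultimately show ?case
    by - (rule strong_collapse.step[of x V "r x"], auto)
qed

lemma strong_collapse_cone:
  assumes "finite V" "c \<in> V" "reflp R" "\<And>v. v \<in> V \<Longrightarrow> R v c \<and> R c v"
  shows "strong_collapse R V {c}"
proof -
  have "strong_collapse R V (V - (V - {c}))"
    by (rule strong_collapse_removal[of _ _ "\<lambda>_. c" _ "\<lambda>_. 0"]) (use assms in auto)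
  moreover have "V - (V - {c}) = {c}" using assms by auto
  ultimately show ?thesis by simp
qed

section \<open>Closure operators on finite posets\<close>

definition comparable :: "'a::order \<Rightarrow> 'a \<Rightarrow> bool" where
  "comparable x y \<longleftrightarrow> x \<le> y \<or> y \<le> x"

text \<open>For a decreasing \<open>r\<close> the points outside \<open>P'\<close> are deleted from
  the bottom up. A point \<open>y\<close> above \<open>x\<close> is above \<open>r x\<close>; a
  \<open>y\<close> below \<open>x\<close> is either deleted already, or in \<open>P'\<close> and
  then \<open>y = r y \<le> r x\<close>. The increasing case is dual.\<close>

lemma strong_collapse_closure:
  fixes P :: "'a::order set"
  assumes "finite P" "P' \<subseteq> P" "mono_on P r" "\<And>x. x \<in> P \<Longrightarrow> r x \<in> P'"
    and "\<And>x. x \<in> P' \<Longrightarrow> r x = x" "(\<forall>x\<in>P. r x \<le> x) \<or> (\<forall>x\<in>P. x \<le> r x)"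
  shows "strong_collapse comparable P P'"
proof -
  have mono: "r x \<le> r y" if "x \<in> P" "y \<in> P" "x \<le> y" for x y
    using that assms(3) by (rule mono_onD[rotated])
  have "P - (P - P') = P'" using assms(2) by auto
  moreover have "strong_collapse comparable P (P - (P - P'))"
    using assms(6)
  proof
    assume le: "\<forall>x\<in>P. r x \<le> x"
    show ?thesis
    proof (rule strong_collapse_removal[where r = r and m = "\<lambda>x. card {y \<in> P. y < x}"])
      fix x y assume x: "x \<in> P - P'" and y: "y \<in> P" and xy: "comparable x y"
      show "comparable (r x) y \<or> (y \<in> P - P' \<and> card {z \<in> P. z < y} < card {z \<in> P. z < x})"
      proof (cases "x \<le> y \<or> y \<in> P'")
        case xyP: True
        show ?thesis
        proof (cases "x \<le> y")
          case True
          moreover have "r x \<le> x" using le x by auto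
          ultimately show ?thesis using order_trans unfolding comparable_def by blast
        next
          case False
          then have "y \<le> x" "r y = y" using xyP xy assms(5) unfolding comparable_def by auto
          then have "y \<le> r x" using mono[of y x] x y by auto
          then show ?thesis unfolding comparable_def by blast
        qed
      next
        case False
        then have "y < x" using xy unfolding comparable_def by auto
        then have "{z \<in> P. z < y} \<subset> {z \<in> P. z < x}" using y by auto
        then show ?thesis using False y assms(1) by (simp add: psubset_card_mono)
      qed
    qed (use assms le in \<open>auto simp: comparable_def\<close>)
  next
    assume le: "\<forall>x\<in>P. x \<le> r x"
    show ?thesis
    proof (rule strong_collapse_removal[where r = r and m = "\<lambda>x. card {y \<in> P. x < y}"])
      fix x y assume x: "x \<in> P - P'" and y: "y \<in> P" and xy: "comparable x y"
      show "comparable (r x) y \<or> (y \<in> P - P' \<and> card {z \<in> P. y < z} < card {z \<in> P. x < z})"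
      proof (cases "y \<le> x \<or> y \<in> P'")
        case xyP: True
        show ?thesis
        proof (cases "y \<le> x")
          case True
          moreover have "x \<le> r x" using le x by auto
          ultimately show ?thesis using order_trans unfolding comparable_def by blast
        next
          case False
          then have "x \<le> y" "r y = y" using xyP xy assms(5) unfolding comparable_def by auto
          then have "r x \<le> y" using mono[of x y] x y by auto
          then show ?thesis unfolding comparable_def by blast
        qed
      next
        case False
        then have "x < y" using xy unfolding comparable_def by auto
        then have "{z \<in> P. y < z} \<subset> {z \<in> P. x < z}" using y by auto
        then show ?thesis using False y assms(1) by (simp add: psubset_card_mono)
      qed
    qed (use assms le in \<open>auto simp: comparable_def\<close>)
  qed
  ultimately show ?thesis by simp
qed

section \<open>Homotopy equivalences from collapses\<close>

lemma homotopy_equivalent_strong_collapse: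
  assumes "strong_collapse R V V'" "finite V" "symp R" "reflp R"
  shows "top_of_set (flag_real R V) homotopy_equivalent_space top_of_set (flag_real R V')"
  using assms
proof (induction rule: strong_collapse.induct)
  case (refl V)
  show ?case by (rule homotopy_equivalent_space_refl)
next
  case (step v V w V')
  then have "top_of_set (flag_real R V) homotopy_equivalent_space top_of_set (flag_real R (V - {v}))"
    by (intro flag_real_remove_dominated[of _ _ _ w]) auto
  moreover have "top_of_set (flag_real R (V - {v})) homotopy_equivalent_space top_of_set (flag_real R V')"
    using step by auto
  ultimately show ?case
    by (rule homotopy_eqv_trans)
qed

text \<open>
  A collapse of the neighbourhood of \<open>v\<close> is mirrored by removing the edges from \<open>v\<close> to the collapsed
  vertices, until a single neighbour is left and dominates \<open>v\<close>.
\<close>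

lemma flag_real_remove_vertex:
  assumes "strong_collapse R N N'" "N' = {c}" "N = {u \<in> V. R v u} - {v}"
    "finite V" "symp R" "reflp R" "v \<in> V"
  shows "top_of_set (flag_real R V) homotopy_equivalent_space top_of_set (flag_real R (V - {v}))"
  using assms
proof (induction "card N" arbitrary: R N)
  case 0
  have "c \<in> N" using strong_collapse_subset[OF 0(2)] 0(3) by simp
  moreover have "finite N" using 0(4,5) by simp
  ultimately show ?case using 0(1) by auto
next
  case (Suc n)
  have sy: "R a b \<Longrightarrow> R b a" for a b using \<open>symp R\<close> by (rule sympD)
  have re: "R a a" for a using \<open>reflp R\<close> by (rule reflpD)
  show ?case
    using Suc.prems(1)
  proof cases
    case refl
    then have "c \<in> V" "c \<noteq> v" "R v c" and "\<And>y. y \<in> V \<Longrightarrow> R v y \<Longrightarrow> y = c \<or> y = v"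
      using Suc.prems by auto
    moreover from this have "R c y" if "y \<in> V" "R v y" for y
      using that re[of c] sy[of v c] by blast
    ultimately show ?thesis
      using Suc.prems(4-7) by (intro flag_real_remove_dominated[of _ _ _ c])
  next
    case (step u w)
    let ?R = "\<lambda>a b. R a b \<and> {a, b} \<noteq> {u, v}"
    have uw: "u \<in> V" "u \<noteq> v" "R v u" "w \<in> V" "w \<noteq> v" "R v w"
      using step Suc.prems by auto
    \<comment> \<open>A common neighbour of \<open>u\<close> and \<open>v\<close> is
      \<open>v\<close> itself or lies in \<open>N\<close>, where \<open>w\<close> dominates
      \<open>u\<close>. Hence \<open>w\<close> dominates the edge between \<open>u\<close> and
      \<open>v\<close>.\<close>
    have "R w y" if "y \<in> V" "R u y" "R v y" for y
      using that step(5)[of y] uw sy[of v w] Suc.prems(3) by (cases "y = v") auto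
    then have e1: "top_of_set (flag_real R V) homotopy_equivalent_space top_of_set (flag_real ?R V)"
      using step uw Suc.prems by (intro flag_real_remove_edge[of _ _ _ _ w]) auto
    \<comment> \<open>Only an edge at \<open>v\<close> was removed, so the relation on
      \<open>N - {u}\<close> is unchanged and the rest of the collapse still applies.\<close>
    have e2: "top_of_set (flag_real ?R V) homotopy_equivalent_space top_of_set (flag_real ?R (V - {v}))"
    proof (rule Suc.hyps(1))
      show "strong_collapse ?R (N - {u}) N'"
        using step(6) by (rule strong_collapse_cong) (use Suc.prems in auto)
      show "N - {u} = {x \<in> V. R v x \<and> {v, x} \<noteq> {u, v}} - {v}"
        using Suc.prems uw by (auto simp: doubleton_eq_iff)
      show "symp ?R" by (rule sympI) (metis sy insert_commute)
      show "reflp ?R" using re uw by (auto intro!: reflpI)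
      show "n = card (N - {u})"
        using Suc.hyps(2) step by (simp add: card_Diff_singleton)
    qed (use Suc.prems in auto)
    have e3: "flag_real ?R (V - {v}) = flag_real R (V - {v})"
      by (rule flag_real_cong) (auto simp: doubleton_eq_iff)
    show ?thesis
      using homotopy_eqv_trans[OF e1 e2] unfolding e3 .
  qed
qed

section \<open>Order complexes and cross-polytopes\<close>

text \<open>Order complexes are clique complexes of comparability, so only the coordinates change:
  \<open>?F\<close> extends by zero and \<open>?G\<close> restricts to a function that is
  extensional on \<open>P\<close>. The injection \<open>f\<close> makes room for further vertices;
  later it is \<open>Inl\<close>.\<close>

lemma geometric_realization_order_complex:
  fixes P :: "'a::order set" and f :: "'a \<Rightarrow> 'b"
  assumes "finite P" "inj_on f P" "\<And>p q. p \<in> P \<Longrightarrow> q \<in> P \<Longrightarrow> R (f p) (f q) = comparable p q"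
  shows "geometric_realization (order_complex P) homeomorphic_space top_of_set (flag_real R (f ` P))"
proof -
  let ?F = "\<lambda>x w. if w \<in> f ` P then x (inv_into P f w) else (0::real)"
  let ?G = "\<lambda>y. restrict (\<lambda>p. y (f p)) P :: 'a \<Rightarrow> real"
  let ?T = "{x. (\<forall>v\<in>P. 0 \<le> x v) \<and> {v \<in> P. x v \<noteq> 0} \<in> order_complex P \<and>
           (\<Sum>v | v \<in> P \<and> x v \<noteq> 0. x v) = (1::real)}"
  have U: "\<Union>(order_complex P) = P"
  proof
    have "{p} \<in> order_complex P" if "p \<in> P" for p
      using that by (simp add: order_complex_def Complete_Partial_Order.chain_def)
    then show "P \<subseteq> \<Union>(order_complex P)" by blast
  qed (auto simp: order_complex_def)
  have X: "geometric_realization (order_complex P) = subtopology (powertop_real P) ?T"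
    by (simp add: geometric_realization_def U)
  have inv: "inv_into P f (f p) = p" if "p \<in> P" for p
    using assms(2) that by simp
  have sup: "(\<Sum>v | v \<in> P \<and> x v \<noteq> 0. x v) = sum x P" for x :: "'a \<Rightarrow> real"
    using assms(1) by (intro sum.mono_neutral_left) auto
  have T: "x \<in> ?T \<longleftrightarrow> (\<forall>v\<in>P. 0 \<le> x v) \<and> sum x P = 1 \<and>
      (\<forall>u\<in>P. \<forall>v\<in>P. x u \<noteq> 0 \<longrightarrow> x v \<noteq> 0 \<longrightarrow> comparable u v)" for x
    unfolding sup using assms(1)
    by (auto simp: order_complex_def Complete_Partial_Order.chain_def comparable_def)
  have FT: "?F x \<in> flag_real R (f ` P)" if "x \<in> ?T" for x
  proof -
    have "sum (?F x) (f ` P) = (\<Sum>p\<in>P. ?F x (f p))"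
      using assms(2) by (simp add: sum.reindex)
    also have "\<dots> = sum x P"
      by (rule sum.cong) (auto simp: inv)
    finally show ?thesis
      using that unfolding T flag_real_def by (auto simp: inv assms(3))
  qed
  have GT: "?G y \<in> ?T \<inter> extensional P" if y: "y \<in> flag_real R (f ` P)" for y
  proof -
    have "sum (?G y) P = sum y (f ` P)"
      using assms(2) by (simp add: sum.reindex)
    moreover have "comparable u v" if "u \<in> P" "v \<in> P" "y (f u) \<noteq> 0" "y (f v) \<noteq> 0" for u v
      using that y assms(3)[of u v] unfolding flag_real_def by blast
    ultimately show ?thesis
      using y unfolding Int_iff T by (auto simp: flag_real_def)
  qed
  have "homeomorphic_maps (subtopology (powertop_real P) ?T) (top_of_set (flag_real R (f ` P))) ?F ?G"
    unfolding homeomorphic_maps_def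
  proof (intro conjI ballI)
    have "continuous_map (subtopology (powertop_real P) ?T) euclideanreal (\<lambda>x. ?F x w)" for w
      by (cases "w \<in> f ` P") (auto simp: inv intro!: continuous_map_from_subtopology continuous_map_product_projection)
    then have "continuous_map (subtopology (powertop_real P) ?T) euclidean ?F"
      unfolding euclidean_product_topology[symmetric] continuous_map_componentwise_UNIV by blast
    then show "continuous_map (subtopology (powertop_real P) ?T) (top_of_set (flag_real R (f ` P))) ?F"
      using FT by (auto simp: continuous_map_in_subtopology)
    have "continuous_map (top_of_set (flag_real R (f ` P))) (powertop_real P) ?G"
      unfolding continuous_map_componentwise
      by (auto intro: continuous_on_subset[OF continuous_on_product_coordinates])
    then show "continuous_map (top_of_set (flag_real R (f ` P))) (subtopology (powertop_real P) ?T) ?G"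
      using GT by (auto simp: continuous_map_in_subtopology)
    show "?G (?F x) = x" if "x \<in> topspace (subtopology (powertop_real P) ?T)" for x
    proof
      fix p show "?G (?F x) p = x p"
        using that by (cases "p \<in> P") (auto simp: inv PiE_def extensional_def)
    qed
    show "?F (?G y) = y" if "y \<in> topspace (top_of_set (flag_real R (f ` P)))" for y
    proof
      fix w show "?F (?G y) w = y w"
        using that by (auto simp: inv flag_real_def)
    qed
  qed
  then show ?thesis
    unfolding X homeomorphic_space_def by blast
qed

text \<open>At most one of \<open>a i\<close> and \<open>b i\<close> carries weight in a clique, so
  a point is determined by its signed coordinates \<open>D x i\<close>, whose absolute values sum to
  1. Radial rescaling takes this unit sphere of the 1-norm \<open>?n1\<close> to that of the 2-norm
  \<open>?n2\<close>; \<open>G\<close> goes back through positive and negative parts.\<close>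

lemma flag_real_cross_polytope:
  fixes a b :: "nat \<Rightarrow> 'a"
  assumes inj: "inj_on a {..d}" "inj_on b {..d}" and disj: "a ` {..d} \<inter> b ` {..d} = {}"
    and R: "\<And>i j. i \<le> d \<Longrightarrow> j \<le> d \<Longrightarrow> R (a i) (a j) \<and> R (b i) (b j)"
      "\<And>i j. i \<le> d \<Longrightarrow> j \<le> d \<Longrightarrow> R (a i) (b j) = (i \<noteq> j) \<and> R (b j) (a i) = (i \<noteq> j)"
  shows "top_of_set (flag_real R (a ` {..d} \<union> b ` {..d})) homeomorphic_space nsphere d"
proof -
  let ?V = "a ` {..d} \<union> b ` {..d}"
  let ?n1 = "\<lambda>y. \<Sum>i\<le>d. \<bar>y i\<bar> :: real" and ?n2 = "\<lambda>y. sqrt (\<Sum>i\<le>d. (y i)\<^sup>2) :: real"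
  define D where "D x i = (if i \<le> d then x (a i) - x (b i) else 0)" for x :: "'a \<Rightarrow> real" and i
  define F where "F x i = D x i / ?n2 (D x)" for x i
  define G where "G y v = (if v \<in> a ` {..d} then max 0 (y (inv_into {..d} a v)) / ?n1 y
    else if v \<in> b ` {..d} then max 0 (- y (inv_into {..d} b v)) / ?n1 y else 0)" for y v
  have sumV: "sum x ?V = (\<Sum>i\<le>d. x (a i) + x (b i))" for x :: "'a \<Rightarrow> real"
    using inj disj by (simp add: sum.union_disjoint sum.reindex sum.distrib)
  have x: "\<bar>D x i\<bar> = x (a i) + x (b i)" "x (a i) = max 0 (D x i)" "x (b i) = max 0 (- D x i)"
    if "x \<in> flag_real R ?V" "i \<le> d" for x i
  proof -
    have "x (a i) = 0 \<or> x (b i) = 0" "0 \<le> x (a i)" "0 \<le> x (b i)"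
      using that R(2)[of i i] unfolding flag_real_def by blast+
    then show "\<bar>D x i\<bar> = x (a i) + x (b i)" "x (a i) = max 0 (D x i)" "x (b i) = max 0 (- D x i)"
      using that by (auto simp: D_def)
  qed
  have n1D: "?n1 (D x) = 1" if "x \<in> flag_real R ?V" for x
  proof -
    have "?n1 (D x) = (\<Sum>i\<le>d. x (a i) + x (b i))"
      by (rule sum.cong) (use x(1)[OF that] in auto)
    then show ?thesis
      using that sumV[of x] by (simp add: flag_real_def)
  qed
  have n2: "?n2 y > 0" if "?n1 y \<noteq> 0" for y
  proof -
    have "\<not> (\<forall>i\<le>d. y i = 0)"
    proof
      assume "\<forall>i\<le>d. y i = 0"
      then have "?n1 y = 0" by simp
      with that show False by simp
    qed
    then obtain i where "i \<le> d" "y i \<noteq> 0" by blast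
    then have "0 < (\<Sum>i\<le>d. (y i)\<^sup>2)"
      by - (rule sum_pos2[of _ i], auto)
    then show ?thesis by simp
  qed
  have n1: "?n1 y > 0" if "(\<Sum>i\<le>d. (y i)\<^sup>2) = 1" for y
  proof -
    have "\<not> (\<forall>i\<le>d. y i = 0)"
    proof
      assume "\<forall>i\<le>d. y i = 0"
      then have "(\<Sum>i\<le>d. (y i)\<^sup>2) = 0" by simp
      with that show False by simp
    qed
    then obtain i where "i \<le> d" "y i \<noteq> 0" by blast
    then show ?thesis
      by - (rule sum_pos2[of _ i], auto)
  qed
  have Ga: "G y (a i) = max 0 (y i) / ?n1 y" and Gb: "G y (b i) = max 0 (- y i) / ?n1 y" if "i \<le> d" for y i
    using that inj disj by (auto simp: G_def)
  have FT: "F x \<in> {y. (\<Sum>i\<le>d. (y i)\<^sup>2) = 1 \<and> (\<forall>i>d. y i = 0)}" if "x \<in> flag_real R ?V" for x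
  proof -
    have "(\<Sum>i\<le>d. (F x i)\<^sup>2) = (\<Sum>i\<le>d. (D x i)\<^sup>2) / (?n2 (D x))\<^sup>2"
      by (simp add: F_def power_divide sum_divide_distrib)
    also have "\<dots> = 1"
      using n2[of "D x"] n1D[OF that] by (simp add: sum_nonneg)
    finally show ?thesis by (simp add: F_def D_def)
  qed
  have GT: "G y \<in> flag_real R ?V" if y: "(\<Sum>i\<le>d. (y i)\<^sup>2) = 1" for y
  proof -
    have "sum (G y) ?V = (\<Sum>i\<le>d. \<bar>y i\<bar> / ?n1 y)"
      unfolding sumV by (rule sum.cong) (use n1[OF y] in \<open>auto simp: Ga Gb max_def simp flip: add_divide_distrib\<close>)
    also have "\<dots> = 1"
      using n1[OF y] by (simp flip: sum_divide_distrib)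
    finally have "sum (G y) ?V = 1" .
    moreover have "\<forall>v. 0 \<le> G y v"
      using n1[OF y] by (auto simp: G_def)
    moreover have "R u v" if "G y u \<noteq> 0" "G y v \<noteq> 0" for u v
    proof -
      have *: "(\<exists>i\<le>d. w = a i \<and> y i > 0) \<or> (\<exists>i\<le>d. w = b i \<and> y i < 0)" if "G y w \<noteq> 0" for w
      proof (cases "w \<in> a ` {..d}")
        case True
        then show ?thesis using that Ga by (auto simp: max_def split: if_splits)
      next
        case False
        then have "w \<in> b ` {..d}" using that by (auto simp: G_def split: if_splits)
        then show ?thesis using that Gb by (auto simp: max_def split: if_splits)
      qed
      show ?thesis
        using *[OF that(1)] *[OF that(2)] R by (smt (verit))
    qed
    ultimately show ?thesis
      unfolding flag_real_def by (auto simp: G_def)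
  qed
  have "homeomorphic_maps (top_of_set (flag_real R ?V)) (nsphere d) F G"
    unfolding homeomorphic_maps_def nsphere euclidean_product_topology
  proof (intro conjI ballI)
    have "continuous_on (flag_real R ?V) (\<lambda>x. D x i)" for i
      unfolding D_def by (cases "i \<le> d") (auto intro!: continuous_intros continuous_on_subset[OF continuous_on_product_coordinates])
    then have "continuous_on (flag_real R ?V) (\<lambda>x. F x i)" for i
      unfolding F_def using n2[of "D _"] n1D by (intro continuous_intros ballI) (auto simp: less_imp_neq[symmetric])
    then have "continuous_on (flag_real R ?V) F"
      by (rule continuous_on_coordinatewise_then_product)
    then show "continuous_map (top_of_set (flag_real R ?V))
        (top_of_set {x. (\<Sum>i\<le>d. (x i)\<^sup>2) = 1 \<and> (\<forall>i>d. x i = 0)}) F"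
      using FT by (auto simp: continuous_map_in_subtopology)
    let ?S = "{x. (\<Sum>i\<le>d. (x i)\<^sup>2) = 1 \<and> (\<forall>i>d. x i = (0::real))}"
    have "continuous_on ?S (\<lambda>x. x i)" for i
      by (auto intro!: continuous_on_subset[OF continuous_on_product_coordinates])
    moreover have "\<forall>y\<in>?S. ?n1 y \<noteq> 0"
      using n1 by (metis (mono_tags, lifting) less_irrefl mem_Collect_eq)
    ultimately have "continuous_on ?S (\<lambda>y. G y v)" for v
      unfolding G_def by (cases "v \<in> a ` {..d}"; cases "v \<in> b ` {..d}") (auto intro!: continuous_intros continuous_on_max)
    then have "continuous_on ?S G"
      by (rule continuous_on_coordinatewise_then_product)
    then show "continuous_map (top_of_set ?S) (top_of_set (flag_real R ?V)) G"
      using GT by (auto simp: continuous_map_in_subtopology)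
    show "G (F x) = x" if "x \<in> topspace (top_of_set (flag_real R ?V))" for x
    proof
      fix v
      have X: "x \<in> flag_real R ?V" using that by simp
      have pos: "?n2 (D x) > 0" using n2 n1D[OF X] by simp
      have "?n1 (F x) = ?n1 (D x) / ?n2 (D x)"
        using pos by (simp add: F_def sum_divide_distrib)
      then have n1F: "?n1 (F x) = 1 / ?n2 (D x)" using n1D[OF X] by simp
      have mx: "max 0 (r / ?n2 (D x)) / (1 / ?n2 (D x)) = max 0 r" for r
        using pos by (auto simp: max_def field_simps)
      consider i where "v = a i" "i \<le> d" | i where "v = b i" "i \<le> d" | "v \<notin> ?V" by auto
      then show "G (F x) v = x v"
      proof cases
        case 1
        have "G (F x) (a i) = max 0 (D x i / ?n2 (D x)) / (1 / ?n2 (D x))"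
          unfolding Ga[OF 1(2)] n1F by (simp add: F_def[of x i])
        then show ?thesis unfolding 1 mx using x(2)[OF X 1(2)] by simp
      next
        case 2
        have "G (F x) (b i) = max 0 ((- D x i) / ?n2 (D x)) / (1 / ?n2 (D x))"
          unfolding Gb[OF 2(2)] n1F by (simp add: F_def[of x i])
        then show ?thesis unfolding 2 mx using x(3)[OF X 2(2)] by simp
      next
        case 3
        then show ?thesis using X by (auto simp: flag_real_def G_def)
      qed
    qed
    show "F (G y) = y" if "y \<in> topspace (top_of_set ?S)" for y
    proof
      fix i
      have Y: "(\<Sum>i\<le>d. (y i)\<^sup>2) = 1" "\<forall>i>d. y i = 0" using that by auto
      have DG: "D (G y) j = y j / ?n1 y" for j
      proof (cases "j \<le> d")
        case True
        then show ?thesis using Ga[OF True] Gb[OF True] by (auto simp: D_def max_def)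
      next
        case False
        then show ?thesis using Y by (auto simp: D_def)
      qed
      have "?n2 (D (G y)) = 1 / ?n1 y"
        unfolding DG using Y n1[OF Y(1)]
        by (simp add: power_divide real_sqrt_divide flip: sum_divide_distrib)
      then show "F (G y) i = y i"
        unfolding F_def DG using n1[OF Y(1)] by simp
    qed
  qed
  then show ?thesis
    unfolding homeomorphic_space_def by blast
qed

section \<open>Stable subsets\<close>

text \<open>The largest point is chosen first, in step with the collapses below, which proceed from
  the top. Writing \<open>b + \<sigma> j \<le> a\<close> avoids truncated subtraction.\<close>

fun has_stable :: "(nat \<Rightarrow> nat) \<Rightarrow> nat \<Rightarrow> nat set \<Rightarrow> bool" where
  "has_stable \<sigma> 0 A = True"
| "has_stable \<sigma> (Suc j) A = (\<exists>a\<in>A. has_stable \<sigma> j {b \<in> A. b + \<sigma> j \<le> a})"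

lemma has_stable_mono: "has_stable \<sigma> j A \<Longrightarrow> A \<subseteq> B \<Longrightarrow> has_stable \<sigma> j B"
proof (induction j arbitrary: A B)
  case (Suc j)
  then obtain a where "a \<in> A" "has_stable \<sigma> j {b \<in> A. b + \<sigma> j \<le> a}" by auto
  moreover have "{b \<in> A. b + \<sigma> j \<le> a} \<subseteq> {b \<in> B. b + \<sigma> j \<le> a}" using Suc.prems(2) by auto
  ultimately show ?case using Suc.IH Suc.prems(2) by (auto intro!: bexI[of _ a])
qed simp

lemma has_stable_span:
  assumes "has_stable \<sigma> (Suc j) A" "0 \<notin> A"
  shows "\<exists>a\<in>A. Suc (\<Sum>i=1..j. \<sigma> i) \<le> a"
  using assms
proof (induction j arbitrary: A)
  case 0
  then show ?case by (auto simp: Suc_le_eq) (metis neq0_conv)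
next
  case (Suc j)
  from Suc.prems(1) obtain a where a: "a \<in> A" "has_stable \<sigma> (Suc j) {b \<in> A. b + \<sigma> (Suc j) \<le> a}"
    by (metis has_stable.simps(2))
  from Suc.IH[OF a(2)] Suc.prems(2) obtain b where "b + \<sigma> (Suc j) \<le> a" "Suc (\<Sum>i=1..j. \<sigma> i) \<le> b"
    by auto
  with a(1) show ?case by (intro bexI[of _ a]) auto
qed

text \<open>Choosing the largest point \<open>q\<close> as the last one leaves most room below it.
  As 0 is excluded, a truncated \<open>q - \<sigma> j\<close> leaves no point of \<open>A\<close>,
  in agreement with the untruncated condition.\<close>

lemma has_stable_last:
  assumes "q \<in> A" "0 \<notin> A"
  shows "has_stable \<sigma> (Suc j) (A \<inter> {..q}) \<longleftrightarrow> has_stable \<sigma> j (A \<inter> {..q - \<sigma> j})"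
proof -
  have eq: "{b \<in> A \<inter> {..q}. b + \<sigma> j \<le> q} = A \<inter> {..q - \<sigma> j}"
  proof -
    have "(b \<le> q \<and> b + \<sigma> j \<le> q) \<longleftrightarrow> b \<le> q - \<sigma> j" if "b \<in> A" for b
    proof -
      have "b \<noteq> 0" using that assms(2) by metis
      then show ?thesis by arith
    qed
    then show ?thesis by auto
  qed
  show ?thesis
  proof
    assume "has_stable \<sigma> (Suc j) (A \<inter> {..q})"
    then obtain a where a: "a \<le> q" "has_stable \<sigma> j {b \<in> A \<inter> {..q}. b + \<sigma> j \<le> a}" by auto
    have "has_stable \<sigma> j {b \<in> A \<inter> {..q}. b + \<sigma> j \<le> q}"
      by (rule has_stable_mono[OF a(2)]) (use a(1) in auto)
    then show "has_stable \<sigma> j (A \<inter> {..q - \<sigma> j})" unfolding eq .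
  next
    assume "has_stable \<sigma> j (A \<inter> {..q - \<sigma> j})"
    then have "has_stable \<sigma> j {b \<in> A \<inter> {..q}. b + \<sigma> j \<le> q}" unfolding eq .
    then show "has_stable \<sigma> (Suc j) (A \<inter> {..q})" using assms(1) by auto
  qed
qed

lemma elem_at_insert_greater:
  assumes "finite C" "\<And>c. c \<in> C \<Longrightarrow> c < a"
  shows "i \<le> card C \<Longrightarrow> 1 \<le> i \<Longrightarrow> elem_at (insert a C) i = elem_at C i"
    and "elem_at (insert a C) (Suc (card C)) = a"
proof -
  have "sorted_list_of_set (set (sorted_list_of_set C @ [a])) = sorted_list_of_set C @ [a]"
    by (rule sorted_list_of_set.idem_if_sorted_distinct)
      (use assms in \<open>auto simp: sorted_append less_imp_le\<close>)
  then have "sorted_list_of_set (insert a C) = sorted_list_of_set C @ [a]"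
    using assms(1) by simp
  moreover have "length (sorted_list_of_set C) = card C"
    using assms(1) by simp
  ultimately show "i \<le> card C \<Longrightarrow> 1 \<le> i \<Longrightarrow> elem_at (insert a C) i = elem_at C i"
    and "elem_at (insert a C) (Suc (card C)) = a"
    by (auto simp: elem_at_def nth_append)
qed

lemma elem_at_in: "finite C \<Longrightarrow> 1 \<le> i \<Longrightarrow> i \<le> card C \<Longrightarrow> elem_at C i \<in> C"
  using nth_mem[of "i - 1" "sorted_list_of_set C"] by (simp add: elem_at_def)

lemma le_last_elem_at:
  assumes "finite C" "c \<in> C"
  shows "c \<le> elem_at C (card C)"
proof -
  obtain i where i: "i < card C" "sorted_list_of_set C ! i = c"
    using assms by (metis in_set_conv_nth length_sorted_list_of_set set_sorted_list_of_set)
  then have "sorted_list_of_set C ! i \<le> sorted_list_of_set C ! (card C - 1)"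
    by (intro sorted_nth_mono) auto
  then show ?thesis using i by (simp add: elem_at_def)
qed

text \<open>The point chosen by the recursion becomes the maximum of the subset, and conversely the
  maximum is split off. Positive gaps put the new point above all earlier ones, so the earlier
  positions in the sorted list do not move.\<close>

lemma has_stable_iff:
  assumes "\<And>i. 1 \<le> \<sigma> i" "finite A"
  shows "has_stable \<sigma> j A \<longleftrightarrow>
    (\<exists>C\<subseteq>A. card C = j \<and> (\<forall>i\<in>{1..j-1}. elem_at C i + \<sigma> i \<le> elem_at C (i + 1)))"
  using assms(2)
proof (induction j arbitrary: A)
  case 0
  show ?case by (auto intro: exI[of _ "{}"])
next
  case (Suc j)
  show ?case
  proof
    assume "has_stable \<sigma> (Suc j) A"
    then obtain a where a: "a \<in> A" "has_stable \<sigma> j {b \<in> A. b + \<sigma> j \<le> a}"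
      unfolding has_stable.simps by blast
    have fA: "finite {b \<in> A. b + \<sigma> j \<le> a}" using Suc.prems by simp
    obtain C where C: "C \<subseteq> {b \<in> A. b + \<sigma> j \<le> a}" "card C = j"
      "\<forall>i\<in>{1..j-1}. elem_at C i + \<sigma> i \<le> elem_at C (i + 1)"
      using iffD1[OF Suc.IH[OF fA] a(2)] by blast
    have fC: "finite C" using C(1) fA by (rule finite_subset)
    have lt: "c < a" if "c \<in> C" for c
    proof -
      have "c + \<sigma> j \<le> a" using C(1) that by blast
      then show ?thesis using assms(1)[of j] by linarith
    qed
    note e = elem_at_insert_greater[OF fC lt]
    have "elem_at (insert a C) i + \<sigma> i \<le> elem_at (insert a C) (i + 1)" if "i \<in> {1..j}" for i
    proof (cases "i = j")
      case True
      then have "elem_at C i \<in> C" using elem_at_in[OF fC] that C(2) by simp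
      then have "elem_at C i + \<sigma> i \<le> a" using C(1) True by blast
      then show ?thesis using that C(2) e True by simp
    next
      case False
      then have "i \<in> {1..j-1}" using that by auto
      then show ?thesis using C(2,3) e(1)[of i] e(1)[of "i + 1"] by auto
    qed
    moreover have "card (insert a C) = Suc j"
      using fC lt C(2) by (subst card_insert_disjoint) auto
    ultimately show "\<exists>C\<subseteq>A. card C = Suc j \<and> (\<forall>i\<in>{1..Suc j-1}. elem_at C i + \<sigma> i \<le> elem_at C (i + 1))"
      using a(1) C(1) by (intro exI[of _ "insert a C"]) auto
  next
    assume "\<exists>C\<subseteq>A. card C = Suc j \<and> (\<forall>i\<in>{1..Suc j-1}. elem_at C i + \<sigma> i \<le> elem_at C (i + 1))"
    then obtain C where C: "C \<subseteq> A" "card C = Suc j" "\<forall>i\<in>{1..j}. elem_at C i + \<sigma> i \<le> elem_at C (i + 1)"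
      unfolding diff_Suc_1 by blast
    have fC: "finite C" "C \<noteq> {}" using C(2) by (auto intro: card_ge_0_finite)
    define a where "a = Max C"
    define C' where "C' = C - {a}"
    have "a \<in> C" unfolding a_def by (rule Max_in[OF fC])
    then have a: "a \<in> C" "C = insert a C'" "finite C'" "card C' = j"
      using fC C(2) by (auto simp: C'_def card_Diff_singleton)
    have lt: "c < a" if "c \<in> C'" for c
      using that fC unfolding C'_def a_def by (auto simp: order.strict_iff_order)
    note e = elem_at_insert_greater[OF a(3) lt, folded a(2)]
    \<comment> \<open>It suffices to bound the last element of \<open>C'\<close>; the given
      \<open>c\<close> shows that there is one, that is \<open>1 \<le> j\<close>.\<close>
    have "C' \<subseteq> {b \<in> A. b + \<sigma> j \<le> a}"
    proof
      fix c assume c: "c \<in> C'"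
      then have "1 \<le> j" using a by (metis One_nat_def Suc_leI card_gt_0_iff empty_iff)
      then have "elem_at C j + \<sigma> j \<le> elem_at C (j + 1)"
        using C(3) by auto
      then have "elem_at C' j + \<sigma> j \<le> a"
        using e(1)[of j] e(2) a(4) \<open>1 \<le> j\<close> by simp
      then show "c \<in> {b \<in> A. b + \<sigma> j \<le> a}"
        using le_last_elem_at[OF a(3) c] c C(1) a by auto
    qed
    moreover have "\<forall>i\<in>{1..j-1}. elem_at C' i + \<sigma> i \<le> elem_at C' (i + 1)"
    proof
      fix i assume "i \<in> {1..j-1}"
      then have i: "i \<in> {1..j}" "i + 1 \<le> j" by auto
      have "elem_at C i + \<sigma> i \<le> elem_at C (i + 1)" using C(3) i(1) by blast
      then show "elem_at C' i + \<sigma> i \<le> elem_at C' (i + 1)"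
        using e(1)[of i] e(1)[of "i + 1"] a(4) i by simp
    qed
    ultimately have "has_stable \<sigma> j {b \<in> A. b + \<sigma> j \<le> a}"
      using Suc.IH[of "{b \<in> A. b + \<sigma> j \<le> a}"] Suc.prems a(4) by (simp, blast)
    then show "has_stable \<sigma> (Suc j) A" using a(1) C(1) unfolding has_stable.simps by blast
  qed
qed

declare has_stable.simps(2) [simp del]

section \<open>Contractible families of pairs\<close>

text \<open>A stage of the alternating process: above the thresholds \<open>p\<close> and
  \<open>q\<close> the two sets are settled as \<open>E\<close> and \<open>F\<close>, while
  \<open>i\<close> and \<open>j\<close> points remain to be found at or below them.\<close>

definition stable_family ::
  "(nat \<Rightarrow> nat) \<Rightarrow> nat \<Rightarrow> nat \<Rightarrow> nat \<Rightarrow> nat \<Rightarrow> nat set \<Rightarrow> nat set \<Rightarrow> (nat set \<times> nat set) set" where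
  "stable_family \<sigma> p q i j E F = {(X, Y). X \<inter> Y = {} \<and> 0 \<notin> X \<and> 0 \<notin> Y \<and>
     X \<inter> {p<..} = E \<and> Y \<inter> {q<..} = F \<and> has_stable \<sigma> i (X \<inter> {..p}) \<and> has_stable \<sigma> j (Y \<inter> {..q})}"

lemma finite_stable_family:
  assumes "finite E" "finite F"
  shows "finite (stable_family \<sigma> p q i j E F)"
proof (rule finite_subset)
  have "X \<subseteq> {..p} \<union> E" if "X \<inter> {p<..} = E" for X E :: "nat set" and p
    using that by fastforce
  then show "stable_family \<sigma> p q i j E F \<subseteq> Pow ({..p} \<union> E) \<times> Pow ({..q} \<union> F)"
    unfolding stable_family_def by blast
qed (use assms in simp)

lemma stable_family_swap: "stable_family \<sigma> p q i j E F = prod.swap ` stable_family \<sigma> q p j i F E"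
proof (rule set_eqI)
  fix z :: "nat set \<times> nat set"
  have "z \<in> stable_family \<sigma> p q i j E F \<longleftrightarrow> prod.swap z \<in> stable_family \<sigma> q p j i F E"
    by (cases z) (auto simp: stable_family_def)
  also have "\<dots> \<longleftrightarrow> z \<in> prod.swap ` stable_family \<sigma> q p j i F E"
    by (metis image_iff swap_swap)
  finally show "z \<in> stable_family \<sigma> p q i j E F \<longleftrightarrow> z \<in> prod.swap ` stable_family \<sigma> q p j i F E" .
qed

lemma strong_collapse_swap:
  fixes P P' :: "('a::order \<times> 'b::order) set"
  assumes "strong_collapse comparable P P'"
  shows "strong_collapse comparable (prod.swap ` P) (prod.swap ` P')"
  using assms
  by (rule strong_collapse_image) (auto simp: comparable_def)

text \<open>First \<open>p\<close> is added to the first set, an increasing operator;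
  \<open>p\<close> cannot lie in the second set, whose part above \<open>q\<close> is
  \<open>F\<close>. Then the points strictly between \<open>p - \<sigma> i\<close> and
  \<open>p\<close> are discarded, a decreasing operator that preserves stability by
  \<open>has_stable_last\<close>.\<close>

lemma stable_family_collapse_left:
  assumes "q < p" "p \<notin> F" "1 \<le> \<sigma> i" "E \<subseteq> {p<..}" "finite E" "finite F"
  shows "strong_collapse comparable (stable_family \<sigma> p q (Suc i) j E F)
           (stable_family \<sigma> (p - \<sigma> i) q i j (insert p E) F)"
proof -
  let ?P = "stable_family \<sigma> p q (Suc i) j E F"
  let ?P1 = "{z \<in> ?P. p \<in> fst z}"
  let ?P2 = "stable_family \<sigma> (p - \<sigma> i) q i j (insert p E) F"
  have lt: "p - \<sigma> i < p" using assms by simp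
  have fin: "finite ?P" by (rule finite_stable_family) fact+
  have "strong_collapse comparable ?P ?P1"
  proof (rule strong_collapse_closure[where r = "\<lambda>z. (insert p (fst z), snd z)"])
    fix z assume z: "z \<in> ?P"
    obtain X Y where XY: "z = (X, Y)" by (cases z)
    have "p \<notin> Y" using z assms(1,2) by (auto simp: stable_family_def XY)
    moreover have "insert p X \<inter> {p<..} = X \<inter> {p<..}" by auto
    moreover have "has_stable \<sigma> (Suc i) (insert p X \<inter> {..p})"
      by (rule has_stable_mono[of _ _ "X \<inter> {..p}"]) (use z in \<open>auto simp: stable_family_def XY\<close>)
    ultimately show "(insert p (fst z), snd z) \<in> ?P1"
      using z assms(1) unfolding stable_family_def XY by simp
  next
    show "mono_on ?P (\<lambda>z. (insert p (fst z), snd z))"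
      by (auto simp: mono_on_def less_eq_prod_def)
  qed (use fin in \<open>auto simp: insert_absorb less_eq_prod_def\<close>)
  moreover have "strong_collapse comparable ?P1 ?P2"
  proof (rule strong_collapse_closure[where r = "\<lambda>z. (fst z - {p - \<sigma> i<..<p}, snd z)"])
    show "?P2 \<subseteq> ?P1"
    proof
      fix z assume z: "z \<in> ?P2"
      obtain X Y where XY: "z = (X, Y)" by (cases z)
      have X: "X \<inter> {p - \<sigma> i<..} = insert p E" "0 \<notin> X" "has_stable \<sigma> i (X \<inter> {..p - \<sigma> i})"
        using z by (auto simp: stable_family_def XY)
      then have "p \<in> X" by blast
      moreover have "X \<inter> {p<..} = (X \<inter> {p - \<sigma> i<..}) \<inter> {p<..}" using lt by auto
      moreover have "insert p E \<inter> {p<..} = E" using assms(4) by auto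
      ultimately show "z \<in> ?P1"
        using z X has_stable_last[of p X \<sigma> i] unfolding stable_family_def XY by simp
    qed
  next
    fix z assume z: "z \<in> ?P1"
    obtain X Y where XY: "z = (X, Y)" by (cases z)
    have X: "X \<inter> {p<..} = E" "p \<in> X" "0 \<notin> X" "has_stable \<sigma> (Suc i) (X \<inter> {..p})"
      using z by (auto simp: stable_family_def XY)
    have "(X - {p - \<sigma> i<..<p}) \<inter> {p - \<sigma> i<..} = insert p (X \<inter> {p<..})"
      using X(2) lt by auto
    moreover have "(X - {p - \<sigma> i<..<p}) \<inter> {..p - \<sigma> i} = X \<inter> {..p - \<sigma> i}"
      by auto
    ultimately show "(fst z - {p - \<sigma> i<..<p}, snd z) \<in> ?P2"
      using z X has_stable_last[of p X \<sigma> i] unfolding stable_family_def XY by auto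
  next
    fix z assume z: "z \<in> ?P2"
    obtain X Y where XY: "z = (X, Y)" by (cases z)
    have "X \<inter> {p - \<sigma> i<..} = insert p E"
      using z by (auto simp: stable_family_def XY)
    then have "X \<inter> {p - \<sigma> i<..<p} = {}" using assms(4) by fastforce
    then show "(fst z - {p - \<sigma> i<..<p}, snd z) = z"
      by (auto simp: XY)
  next
    show "mono_on ?P1 (\<lambda>z. (fst z - {p - \<sigma> i<..<p}, snd z))"
      by (auto simp: mono_on_def less_eq_prod_def)
  qed (use fin in \<open>auto simp: less_eq_prod_def\<close>)
  ultimately show ?thesis by (rule strong_collapse_trans)
qed

lemma stable_family_collapse_right:
  assumes "p < q" "q \<notin> E" "1 \<le> \<sigma> j" "F \<subseteq> {q<..}" "finite E" "finite F"
  shows "strong_collapse comparable (stable_family \<sigma> p q i (Suc j) E F)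
           (stable_family \<sigma> p (q - \<sigma> j) i j E (insert q F))"
  using strong_collapse_swap[OF stable_family_collapse_left[where \<sigma> = \<sigma> and i = j and j = i, OF assms(1,2,3,4,6,5)]]
  by (simp flip: stable_family_swap)

text \<open>With no points left to find, \<open>(E, F)\<close> is the least element, so the constant
  map to it is a decreasing closure operator.\<close>

lemma stable_family_collapse_0:
  assumes "E \<subseteq> {p<..}" "F \<subseteq> {q<..}" "E \<inter> F = {}" "finite E" "finite F"
  shows "strong_collapse comparable (stable_family \<sigma> p q 0 0 E F) {(E, F)}"
proof (rule strong_collapse_closure[where r = "\<lambda>_. (E, F)"])
  have "E \<inter> {p<..} = E" "F \<inter> {q<..} = F" "0 \<notin> E" "0 \<notin> F"
    using assms by auto
  then show "{(E, F)} \<subseteq> stable_family \<sigma> p q 0 0 E F"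
    using assms(3) by (auto simp: stable_family_def)
  show "finite (stable_family \<sigma> p q 0 0 E F)"
    by (rule finite_stable_family) fact+
qed (auto simp: mono_on_def stable_family_def less_eq_prod_def)

text \<open>The left threshold starts one above the right one. Adding \<open>Suc q\<close> on the
  left lowers it by a gap of at least 2, hence below \<open>q\<close>, so \<open>q\<close> can be
  added on the right; this lowers the right threshold by the same gap and restores the offset. The
  bound on \<open>q\<close> leaves room for all gaps.\<close>

lemma stable_family_collapsible:
  assumes \<sigma>: "\<And>i. 2 \<le> \<sigma> i"
    and "Suc (\<Sum>l=1..j. \<sigma> l) \<le> q" "E \<subseteq> {Suc q<..}" "F \<subseteq> {Suc q<..}" "E \<inter> F = {}" "finite E" "finite F"
  shows "\<exists>c. strong_collapse comparable (stable_family \<sigma> (Suc q) q (Suc j) (Suc j) E F) {c}"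
  using assms(2-)
proof (induction j arbitrary: q E F)
  case 0
  let ?E = "insert (Suc q) E" and ?F = "insert q F"
  have "strong_collapse comparable (stable_family \<sigma> (Suc q) q (Suc 0) (Suc 0) E F)
     (stable_family \<sigma> (Suc q - \<sigma> 0) q 0 (Suc 0) ?E F)"
    using 0 \<sigma>[of 0] by (intro stable_family_collapse_left) auto
  moreover have "strong_collapse comparable (stable_family \<sigma> (Suc q - \<sigma> 0) q 0 (Suc 0) ?E F)
     (stable_family \<sigma> (Suc q - \<sigma> 0) (q - \<sigma> 0) 0 0 ?E ?F)"
    using 0 \<sigma>[of 0] by (intro stable_family_collapse_right) auto
  moreover have "strong_collapse comparable (stable_family \<sigma> (Suc q - \<sigma> 0) (q - \<sigma> 0) 0 0 ?E ?F) {(?E, ?F)}"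
    using 0 \<sigma>[of 0] by (intro stable_family_collapse_0) auto
  ultimately show ?case
    by (blast intro: strong_collapse_trans)
next
  case (Suc j)
  let ?E = "insert (Suc q) E" and ?F = "insert q F" and ?s = "\<sigma> (Suc j)"
  \<comment> \<open>The bound on \<open>q\<close> gives \<open>?s \<le> q\<close>, so the
    subtraction does not truncate and the offset of one survives.\<close>
  have s: "2 \<le> ?s" "Suc (\<Sum>l=1..j. \<sigma> l) \<le> q - ?s" "Suc q - ?s = Suc (q - ?s)"
    using \<sigma>[of "Suc j"] Suc.prems(1) by auto
  have "strong_collapse comparable (stable_family \<sigma> (Suc q) q (Suc (Suc j)) (Suc (Suc j)) E F)
     (stable_family \<sigma> (Suc q - ?s) q (Suc j) (Suc (Suc j)) ?E F)"
    using Suc.prems s(1) by (intro stable_family_collapse_left) auto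
  moreover have "strong_collapse comparable (stable_family \<sigma> (Suc q - ?s) q (Suc j) (Suc (Suc j)) ?E F)
     (stable_family \<sigma> (Suc q - ?s) (q - ?s) (Suc j) (Suc j) ?E ?F)"
    using Suc.prems s by (intro stable_family_collapse_right) auto
  moreover have "\<exists>c. strong_collapse comparable (stable_family \<sigma> (Suc (q - ?s)) (q - ?s) (Suc j) (Suc j) ?E ?F) {c}"
    by (rule Suc.IH) (use Suc.prems s in auto)
  ultimately show ?case
    unfolding s(3) by (blast intro: strong_collapse_trans)
qed

section \<open>The poset as an iterated suspension\<close>

definition stable_poset :: "(nat \<Rightarrow> nat) \<Rightarrow> nat \<Rightarrow> nat \<Rightarrow> (nat set \<times> nat set) set" where
  "stable_poset \<sigma> k n = {(A, B). A \<subseteq> {1..n} \<and> B \<subseteq> {1..n} \<and> A \<inter> B = {} \<and> has_stable \<sigma> k A \<and> has_stable \<sigma> k B}"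

lemma finite_stable_poset: "finite (stable_poset \<sigma> k n)"
  by (rule finite_subset[of _ "Pow {1..n} \<times> Pow {1..n}"]) (auto simp: stable_poset_def)

text \<open>Cutting \<open>n\<close> out of the second set is a decreasing operator. It leaves a
  stable family with nothing settled yet and thresholds \<open>n\<close> and \<open>n - 1\<close>,
  the offset with which the alternation starts.\<close>

lemma stable_poset_right_collapsible:
  assumes \<sigma>: "\<And>i. 2 \<le> \<sigma> i" and n: "Suc (\<Sum>l=1..j. \<sigma> l) < n"
  shows "\<exists>c. strong_collapse comparable {z \<in> stable_poset \<sigma> (Suc j) n. has_stable \<sigma> (Suc j) (snd z \<inter> {..<n})} {c}"
proof -
  let ?P = "{z \<in> stable_poset \<sigma> (Suc j) n. has_stable \<sigma> (Suc j) (snd z \<inter> {..<n})}"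
  obtain m where m: "n = Suc m" using n by (cases n) auto
  have "strong_collapse comparable ?P (stable_family \<sigma> (Suc m) m (Suc j) (Suc j) {} {})"
  proof (rule strong_collapse_closure[where r = "\<lambda>z. (fst z, snd z \<inter> {..<n})"])
    have bound: "X \<inter> {..p} = X" "X \<subseteq> {1..p}" if "X \<inter> {p<..} = {}" "0 \<notin> X" for X :: "nat set" and p
    proof -
      have "x \<le> p \<and> 1 \<le> x" if "x \<in> X" for x
        using that \<open>X \<inter> {p<..} = {}\<close> \<open>0 \<notin> X\<close> by (metis IntI One_nat_def Suc_leI empty_iff greaterThan_iff neq0_conv not_le)
      then show "X \<inter> {..p} = X" "X \<subseteq> {1..p}" by auto
    qed
    have less: "{..<n} = {..m}" using m by auto
    show sub: "stable_family \<sigma> (Suc m) m (Suc j) (Suc j) {} {} \<subseteq> ?P"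
    proof
      fix z assume z: "z \<in> stable_family \<sigma> (Suc m) m (Suc j) (Suc j) {} {}"
      obtain X Y where XY: "z = (X, Y)" by (cases z)
      have "X \<inter> {..Suc m} = X" "X \<subseteq> {1..Suc m}" "Y \<inter> {..m} = Y" "Y \<subseteq> {1..m}"
        using z bound[of X "Suc m"] bound[of Y m] by (auto simp: stable_family_def XY)
      moreover from this have "Y \<subseteq> {1..Suc m}" by auto
      ultimately show "z \<in> ?P"
        using z unfolding less by (simp add: stable_family_def stable_poset_def XY m)
    qed
    show "(fst x, snd x \<inter> {..<n}) = x" if "x \<in> stable_family \<sigma> (Suc m) m (Suc j) (Suc j) {} {}" for x
    proof -
      obtain X Y where XY: "x = (X, Y)" by (cases x)
      have "Y \<inter> {..m} = Y"
        using that bound[of Y m] by (simp add: stable_family_def XY)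
      then show ?thesis unfolding less by (simp add: XY)
    qed
    show "(fst x, snd x \<inter> {..<n}) \<in> stable_family \<sigma> (Suc m) m (Suc j) (Suc j) {} {}" if "x \<in> ?P" for x
    proof -
      obtain X Y where XY: "x = (X, Y)" by (cases x)
      have x: "X \<subseteq> {1..Suc m}" "Y \<subseteq> {1..Suc m}" "X \<inter> Y = {}" "has_stable \<sigma> (Suc j) X"
        "has_stable \<sigma> (Suc j) (Y \<inter> {..m})"
        using that less by (auto simp: stable_poset_def XY m)
      then have "X \<inter> {..Suc m} = X" "X \<inter> {Suc m<..} = {}" "0 \<notin> X" "0 \<notin> Y"
        by auto
      then show ?thesis
        using x unfolding less by (auto simp: stable_family_def XY Int_assoc)
    qed
  qed (use finite_stable_poset in \<open>auto simp: mono_on_def less_eq_prod_def\<close>)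
  moreover have "\<exists>c. strong_collapse comparable (stable_family \<sigma> (Suc m) m (Suc j) (Suc j) {} {}) {c}"
    by (rule stable_family_collapsible) (use \<sigma> n m in auto)
  ultimately show ?thesis
    by (blast intro: strong_collapse_trans)
qed

lemma stable_poset_swap: "prod.swap ` {z \<in> stable_poset \<sigma> k n. Q (snd z)} = {z \<in> stable_poset \<sigma> k n. Q (fst z)}"
  by (force simp: stable_poset_def image_iff)

text \<open>
  \<open>Inr (True, t)\<close> and \<open>Inr (False, t)\<close> are the two poles of the suspension from \<open>P (t - 1)\<close> to \<open>P t\<close>;
  they cone off \<open>Q\<^sub>A\<close> and \<open>Q\<^sub>B\<close> at stage \<open>t\<close>.
\<close>

fun suspension_rel :: "(nat \<Rightarrow> nat) \<Rightarrow> nat \<Rightarrow> (nat set \<times> nat set) + (bool \<times> nat) \<Rightarrow> (nat set \<times> nat set) + (bool \<times> nat) \<Rightarrow> bool" where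
  "suspension_rel \<sigma> k (Inl z) (Inl z') = comparable z z'"
| "suspension_rel \<sigma> k (Inl z) (Inr (e, t)) = has_stable \<sigma> k ((if e then snd z else fst z) \<inter> {..<t})"
| "suspension_rel \<sigma> k (Inr (e, t)) (Inl z) = has_stable \<sigma> k ((if e then snd z else fst z) \<inter> {..<t})"
| "suspension_rel \<sigma> k (Inr (e, t)) (Inr (e', t')) = (t \<noteq> t' \<or> e = e')"

lemma symp_suspension_rel: "symp (suspension_rel \<sigma> k)"
proof (rule sympI)
  show "suspension_rel \<sigma> k x y \<Longrightarrow> suspension_rel \<sigma> k y x" for x y
    by (cases "(\<sigma>, k, x, y)" rule: suspension_rel.cases) (auto simp: comparable_def)
qed

lemma reflp_suspension_rel: "reflp (suspension_rel \<sigma> k)"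
proof (rule reflpI)
  show "suspension_rel \<sigma> k x x" for x
    by (cases x) (auto simp: comparable_def)
qed

text \<open>The poles of the stages already passed on the way down from \<open>M\<close> to
  \<open>n\<close>. Each pair of poles is joined with the poset of stage \<open>n\<close> and with
  all other pairs.\<close>

definition poles :: "nat \<Rightarrow> nat \<Rightarrow> ((nat set \<times> nat set) + (bool \<times> nat)) set" where
  "poles n M = Inr ` (UNIV \<times> {n<..M})"

lemma stable_poset_mono: "m \<le> n \<Longrightarrow> stable_poset \<sigma> k m \<subseteq> stable_poset \<sigma> k n"
  by (auto simp: stable_poset_def)

text \<open>This makes the poles of stage \<open>t\<close> adjacent to every pair of an earlier
  stage: cutting below \<open>t\<close> loses nothing there.\<close>

lemma stable_poset_below:
  assumes "z \<in> stable_poset \<sigma> k n" "n < t"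
  shows "has_stable \<sigma> k (fst z \<inter> {..<t})" "has_stable \<sigma> k (snd z \<inter> {..<t})"
proof -
  have "fst z \<inter> {..<t} = fst z" "snd z \<inter> {..<t} = snd z"
    using assms by (auto simp: stable_poset_def)
  then show "has_stable \<sigma> k (fst z \<inter> {..<t})" "has_stable \<sigma> k (snd z \<inter> {..<t})"
    using assms by (auto simp: stable_poset_def)
qed

text \<open>The join of \<open>D\<close> and \<open>U\<close> will be the link of a pole. Collapsing
  \<open>D\<close> to \<open>c\<close> turns it into a cone with apex \<open>c\<close>.\<close>

lemma collapsible_join:
  assumes "strong_collapse comparable D {c}" "finite U"
    "\<And>z u. z \<in> D \<Longrightarrow> u \<in> U \<Longrightarrow> suspension_rel \<sigma> k (Inl z) (Inr u)"
  shows "strong_collapse (suspension_rel \<sigma> k) (Inl ` D \<union> Inr ` U) {Inl c}"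
proof -
  have "strong_collapse (suspension_rel \<sigma> k) (Inl ` D) (Inl ` {c})"
    using assms(1) by (rule strong_collapse_image) auto
  then have "strong_collapse (suspension_rel \<sigma> k) (Inl ` D \<union> Inr ` U) (Inl ` {c} \<union> Inr ` U)"
    by (rule strong_collapse_join) (use assms(3) in auto)
  moreover have "c \<in> D" using strong_collapse_subset[OF assms(1)] by simp
  then have "suspension_rel \<sigma> k (Inl c) (Inr u) \<and> suspension_rel \<sigma> k (Inr u) (Inl c)" if "u \<in> U" for u
    using assms(3)[of c u] sympD[OF symp_suspension_rel, of \<sigma> k "Inl c" "Inr u"] that by blast
  then have "strong_collapse (suspension_rel \<sigma> k) (Inl ` {c} \<union> Inr ` U) {Inl c}"
    by (intro strong_collapse_cone) (use assms(2) in \<open>auto simp: reflp_suspension_rel comparable_def simp del: suspension_rel.simps(2,3)\<close>)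
  ultimately show ?thesis by (rule strong_collapse_trans)
qed

text \<open>The two poles of stage \<open>n\<close> are added by reading a vertex removal backwards:
  their links are \<open>QA\<close> and \<open>QB\<close> joined with the poles of higher stages,
  hence collapsible. Then \<open>?a\<close> dominates the pairs outside \<open>QB\<close>, next
  \<open>?b\<close> those outside \<open>QA\<close>, and what is left of the poset retracts to the
  poset of stage \<open>n - 1\<close>.\<close>

lemma suspension_step:
  assumes \<sigma>: "\<And>i. 2 \<le> \<sigma> i" and n: "Suc (\<Sum>l=1..j. \<sigma> l) < n" "n \<le> M"
  shows "top_of_set (flag_real (suspension_rel \<sigma> (Suc j)) (Inl ` stable_poset \<sigma> (Suc j) n \<union> poles n M)) homotopy_equivalent_space
         top_of_set (flag_real (suspension_rel \<sigma> (Suc j)) (Inl ` stable_poset \<sigma> (Suc j) (n - 1) \<union> poles (n - 1) M))"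
proof -
  let ?k = "Suc j" and ?R = "suspension_rel \<sigma> (Suc j)"
  let ?P = "stable_poset \<sigma> (Suc j) n" and ?P' = "stable_poset \<sigma> (Suc j) (n - 1)"
  let ?a = "Inr (True, n)" and ?b = "Inr (False, n)"
  define QA where "QA = {z \<in> ?P. has_stable \<sigma> ?k (snd z \<inter> {..<n})}"
  define QB where "QB = {z \<in> ?P. has_stable \<sigma> ?k (fst z \<inter> {..<n})}"
  let ?X = "\<lambda>D. Inl ` D \<union> poles n M"
  note sr = symp_suspension_rel[of \<sigma> ?k] reflp_suspension_rel[of \<sigma> ?k]
  have fin[simp]: "finite ?P" "finite (poles n M)" "finite QA" "finite QB"
    by (auto simp: finite_stable_poset poles_def QA_def QB_def)
  have below: "?R (Inl z) (Inr u)" if "z \<in> ?P" "u \<in> UNIV \<times> {n<..M}" for z u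
    using that stable_poset_below[of z \<sigma> ?k n "snd u"] by (cases u) auto
  have new: "?a \<notin> ?X D" "?b \<notin> ?X D" for D
    by (auto simp: poles_def)
  obtain c where c: "strong_collapse comparable QA {c}"
    using stable_poset_right_collapsible[OF \<sigma> n(1)] unfolding QA_def by blast
  have swap: "prod.swap ` QA = QB"
    unfolding QA_def QB_def by (rule stable_poset_swap)
  obtain c' where c': "strong_collapse comparable QB {c'}"
    using strong_collapse_swap[OF c] unfolding swap by auto
  have "top_of_set (flag_real ?R (insert ?a (?X ?P))) homotopy_equivalent_space
        top_of_set (flag_real ?R (insert ?a (?X ?P) - {?a}))"
  proof (rule flag_real_remove_vertex)
    show "strong_collapse ?R (Inl ` QA \<union> Inr ` (UNIV \<times> {n<..M})) {Inl c}"
      by (rule collapsible_join[OF c]) (auto simp: QA_def intro!: below)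
    show "Inl ` QA \<union> Inr ` (UNIV \<times> {n<..M}) = {u \<in> insert ?a (?X ?P). ?R ?a u} - {?a}"
      by (auto simp: QA_def poles_def)
  qed (use sr in auto)
  moreover have "insert ?a (?X ?P) - {?a} = ?X ?P" using new by auto
  ultimately have e1: "top_of_set (flag_real ?R (?X ?P)) homotopy_equivalent_space
     top_of_set (flag_real ?R (insert ?a (?X ?P)))"
    by (metis homotopy_equivalent_space_sym)
  \<comment> \<open>As \<open>?a\<close> and \<open>?b\<close> are not adjacent, the link of
    \<open>?b\<close> is the same with \<open>?a\<close> present.\<close>
  have "top_of_set (flag_real ?R (insert ?b (insert ?a (?X ?P)))) homotopy_equivalent_space
        top_of_set (flag_real ?R (insert ?b (insert ?a (?X ?P)) - {?b}))"
  proof (rule flag_real_remove_vertex)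
    show "strong_collapse ?R (Inl ` QB \<union> Inr ` (UNIV \<times> {n<..M})) {Inl c'}"
      by (rule collapsible_join[OF c']) (auto simp: QB_def intro!: below)
    show "Inl ` QB \<union> Inr ` (UNIV \<times> {n<..M}) = {u \<in> insert ?b (insert ?a (?X ?P)). ?R ?b u} - {?b}"
      by (auto simp: QB_def poles_def)
  qed (use sr in auto)
  moreover have "insert ?b (insert ?a (?X ?P)) - {?b} = insert ?a (?X ?P)" using new by auto
  ultimately have e2: "top_of_set (flag_real ?R (insert ?a (?X ?P))) homotopy_equivalent_space
     top_of_set (flag_real ?R (insert ?b (insert ?a (?X ?P))))"
    by (metis homotopy_equivalent_space_sym)
  have poles: "insert ?b (insert ?a (?X D)) = Inl ` D \<union> poles (n - 1) M" for D
  proof -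
    have "{n - 1<..M} = insert n {n<..M}" using n by auto
    then show ?thesis by (auto simp: poles_def UNIV_bool)
  qed
  have cover: "z \<in> QA \<or> z \<in> QB" if "z \<in> ?P" for z
  proof -
    have "n \<notin> fst z \<or> n \<notin> snd z" "fst z \<subseteq> {1..n}" "snd z \<subseteq> {1..n}"
      using that by (auto simp: stable_poset_def)
    then have "fst z \<inter> {..<n} = fst z \<or> snd z \<inter> {..<n} = snd z"
      by (auto simp: order.strict_iff_order)
    then show ?thesis using that unfolding QA_def QB_def by (auto simp: stable_poset_def)
  qed
  have up: "z' \<in> QA" if "z \<in> QA" "z \<le> z'" "z' \<in> ?P" for z z'
    using that has_stable_mono[of \<sigma> ?k "snd z \<inter> {..<n}" "snd z' \<inter> {..<n}"]
    unfolding QA_def less_eq_prod_def by auto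
  have up': "z' \<in> QB" if "z \<in> QB" "z \<le> z'" "z' \<in> ?P" for z z'
    using that has_stable_mono[of \<sigma> ?k "fst z \<inter> {..<n}" "fst z' \<inter> {..<n}"]
    unfolding QB_def less_eq_prod_def by auto
  \<comment> \<open>A pair \<open>z\<close> outside \<open>QB\<close> is not adjacent to
    \<open>?b\<close>, the only pole that \<open>?a\<close> misses. Whatever is comparable to
    \<open>z\<close> lies in \<open>QA\<close>: above \<open>z\<close> because \<open>QA\<close> is
    an up-set, below \<open>z\<close> because \<open>QB\<close> is an up-set and the two cover the
    poset.\<close>
  have s1: "strong_collapse ?R (Inl ` ?P \<union> poles (n - 1) M) (Inl ` ?P \<union> poles (n - 1) M - Inl ` (?P - QB))"
  proof (rule strong_collapse_removal[where r = "\<lambda>_. ?a" and m = "\<lambda>_. 0"])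
    fix x y assume "x \<in> Inl ` (?P - QB)" and y: "y \<in> Inl ` ?P \<union> poles (n - 1) M" and xy: "?R x y"
    then obtain z where z: "x = Inl z" "z \<in> ?P" "z \<notin> QB" "z \<in> QA" using cover by auto
    show "?R ?a y \<or> y \<in> Inl ` (?P - QB) \<and> (0::nat) < 0"
    proof (cases y)
      case (Inl z')
      then have "z' \<in> ?P" "comparable z z'" using y xy z by (auto simp: poles_def)
      then have "z' \<in> QA" using z up cover up' unfolding comparable_def by metis
      then show ?thesis by (simp add: Inl QA_def)
    next
      case (Inr u)
      then obtain e t where u: "y = Inr (e, t)" "n \<le> t" using y by (cases u) (auto simp: poles_def)
      then show ?thesis
        using xy z by (cases "t = n"; cases e) (auto simp: QB_def)
    qed
  qed (use n in \<open>auto simp: poles_def QA_def QB_def dest: cover\<close>)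
  have t1: "Inl ` ?P \<union> poles (n - 1) M - Inl ` (?P - QB) = Inl ` QB \<union> poles (n - 1) M"
    by (auto simp: poles_def QB_def)
  \<comment> \<open>All remaining pairs lie in \<open>QB\<close> and so are adjacent to
    \<open>?b\<close>; a pair outside \<open>QA\<close> is not adjacent to \<open>?a\<close>, the
    only pole that \<open>?b\<close> misses.\<close>
  have s2: "strong_collapse ?R (Inl ` QB \<union> poles (n - 1) M) (Inl ` QB \<union> poles (n - 1) M - Inl ` (QB - QA))"
  proof (rule strong_collapse_removal[where r = "\<lambda>_. ?b" and m = "\<lambda>_. 0"])
    fix x y assume "x \<in> Inl ` (QB - QA)" and y: "y \<in> Inl ` QB \<union> poles (n - 1) M" and xy: "?R x y"
    then obtain z where z: "x = Inl z" "z \<in> QB" "z \<notin> QA" "z \<in> ?P" by (auto simp: QB_def)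
    show "?R ?b y \<or> y \<in> Inl ` (QB - QA) \<and> (0::nat) < 0"
    proof (cases y)
      case (Inl z')
      then show ?thesis using y by (auto simp: QB_def poles_def)
    next
      case (Inr u)
      then obtain e t where u: "y = Inr (e, t)" "n \<le> t" using y by (cases u) (auto simp: poles_def)
      then show ?thesis
        using xy z by (cases "t = n"; cases e) (auto simp: QA_def)
    qed
  qed (use n in \<open>auto simp: poles_def QA_def QB_def\<close>)
  have t2: "Inl ` QB \<union> poles (n - 1) M - Inl ` (QB - QA) = Inl ` (QA \<inter> QB) \<union> poles (n - 1) M"
    by (auto simp: poles_def)
  \<comment> \<open>Deleting \<open>n\<close> from both sets is a decreasing operator, and on this
    intersection both sets still contain a stable subset afterwards.\<close>
  have "strong_collapse comparable (QA \<inter> QB) ?P'"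
  proof (rule strong_collapse_closure[where r = "\<lambda>z. (fst z \<inter> {..<n}, snd z \<inter> {..<n})"])
    show "?P' \<subseteq> QA \<inter> QB"
      using n stable_poset_mono[of "n - 1" n \<sigma> ?k] stable_poset_below[of _ \<sigma> ?k "n - 1" n]
      by (auto simp: QA_def QB_def)
    show "(fst z \<inter> {..<n}, snd z \<inter> {..<n}) \<in> ?P'" if "z \<in> QA \<inter> QB" for z
      using that by (auto simp: stable_poset_def QA_def QB_def)
    show "(fst z \<inter> {..<n}, snd z \<inter> {..<n}) = z" if "z \<in> ?P'" for z
    proof -
      have "{1..n - 1} \<subseteq> {..<n}" using n by auto
      then have "fst z \<subseteq> {..<n}" "snd z \<subseteq> {..<n}"
        using that unfolding stable_poset_def by auto
      then have "fst z \<inter> {..<n} = fst z" "snd z \<inter> {..<n} = snd z"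
        by auto
      then show ?thesis by simp
    qed
  qed (auto simp: mono_on_def less_eq_prod_def)
  then have "strong_collapse ?R (Inl ` (QA \<inter> QB)) (Inl ` ?P')"
    by (rule strong_collapse_image) auto
  then have s3: "strong_collapse ?R (Inl ` (QA \<inter> QB) \<union> poles (n - 1) M) (Inl ` ?P' \<union> poles (n - 1) M)"
  proof (rule strong_collapse_join)
    fix u v :: "(nat set \<times> nat set) + (bool \<times> nat)"
    assume u: "u \<in> poles (n - 1) M" and "v \<in> Inl ` (QA \<inter> QB)"
    then obtain z where z: "v = Inl z" "z \<in> QA" "z \<in> QB" by auto
    obtain e t where u: "u = Inr (e, t)" "n \<le> t" using u by (auto simp: poles_def)
    show "?R v u"
    proof (cases "t = n")
      case True
      then show ?thesis using z u by (auto simp: QA_def QB_def)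
    next
      case False
      then show ?thesis using stable_poset_below[of z \<sigma> ?k n t] z u by (auto simp: QA_def)
    qed
  qed (auto simp: poles_def)
  have "strong_collapse ?R (Inl ` ?P \<union> poles (n - 1) M) (Inl ` ?P' \<union> poles (n - 1) M)"
    using strong_collapse_trans[OF strong_collapse_trans[OF s1[unfolded t1] s2[unfolded t2]] s3] .
  then have e3: "top_of_set (flag_real ?R (Inl ` ?P \<union> poles (n - 1) M)) homotopy_equivalent_space
      top_of_set (flag_real ?R (Inl ` ?P' \<union> poles (n - 1) M))"
    by (rule homotopy_equivalent_strong_collapse) (use sr in \<open>auto simp: poles_def\<close>)
  show ?thesis
    using homotopy_eqv_trans[OF homotopy_eqv_trans[OF e1 e2[unfolded poles]] e3] .
qed

text \<open>The elements start at 1 and the gaps add up to \<open>n - 1\<close>, so a stable subset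
  has to use \<open>n\<close>; both members of a pair would contain it.\<close>

lemma stable_poset_empty:
  assumes "n = Suc (\<Sum>l=1..j. \<sigma> l)"
  shows "stable_poset \<sigma> (Suc j) n = {}"
proof -
  have *: "n \<in> A" if A: "A \<subseteq> {1..n}" "has_stable \<sigma> (Suc j) A" for A
  proof -
    have "0 \<notin> A" using A by auto
    then obtain a where "a \<in> A" "n \<le> a"
      using has_stable_span[OF A(2)] assms by auto
    with A show ?thesis by (metis antisym atLeastAtMost_iff subsetD)
  qed
  show ?thesis
  proof (rule equals0I)
    fix z assume "z \<in> stable_poset \<sigma> (Suc j) n"
    then have "n \<in> fst z" "n \<in> snd z" "fst z \<inter> snd z = {}"
      using *[of "fst z"] *[of "snd z"] by (auto simp: stable_poset_def)
    then show False by blast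
  qed
qed


text \<open>Each step down trades one stage of the poset for a pair of poles. At stage
  \<open>m\<close> the poset is empty and only poles are left.\<close>

lemma stable_poset_suspension:
  assumes \<sigma>: "\<And>i. 2 \<le> \<sigma> i" and m: "m = Suc (\<Sum>l=1..j. \<sigma> l)" and "m \<le> n" "n \<le> M"
  shows "top_of_set (flag_real (suspension_rel \<sigma> (Suc j)) (Inl ` stable_poset \<sigma> (Suc j) n \<union> poles n M)) homotopy_equivalent_space
         top_of_set (flag_real (suspension_rel \<sigma> (Suc j)) (poles m M))"
  using \<open>m \<le> n\<close> \<open>n \<le> M\<close>
proof (induction n rule: dec_induct)
  case base
  show ?case
    by (simp add: stable_poset_empty[OF m] homotopy_equivalent_space_refl)
next
  case (step n)
  have "top_of_set (flag_real (suspension_rel \<sigma> (Suc j)) (Inl ` stable_poset \<sigma> (Suc j) (Suc n) \<union> poles (Suc n) M)) homotopy_equivalent_space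
        top_of_set (flag_real (suspension_rel \<sigma> (Suc j)) (Inl ` stable_poset \<sigma> (Suc j) n \<union> poles n M))"
    using suspension_step[where \<sigma> = \<sigma> and j = j and n = "Suc n" and M = M, OF \<sigma>] step m by simp
  then show ?case
    by (rule homotopy_eqv_trans) (use step in simp)
qed

text \<open>Since \<open>s k = 1\<close>, the wrap-around condition says that two elements of
  \<open>{1..n}\<close> differ by at most \<open>n - 1\<close>. The gap conditions remain, and
  \<open>has_stable_iff\<close> turns them into the recursion.\<close>

lemma stable_pairs_eq:
  assumes s: "\<And>i. 1 \<le> i \<Longrightarrow> i < k \<Longrightarrow> s i = int (\<sigma> i)" and \<sigma>: "\<And>i. 1 \<le> \<sigma> i" and "1 \<le> k" "s k = 1"
  shows "stable_pairs n k s = stable_poset \<sigma> k n"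
proof -
  have subset: "stable_subset n k s C \<longleftrightarrow> card C = k \<and> (\<forall>i\<in>{1..k-1}. elem_at C i + \<sigma> i \<le> elem_at C (i + 1))"
    if C: "C \<subseteq> {1..n}" for C
  proof -
    have gap: "s i \<le> int (elem_at C (i + 1)) - int (elem_at C i) \<longleftrightarrow> elem_at C i + \<sigma> i \<le> elem_at C (i + 1)"
      if "i \<in> {1..k-1}" for i
      using that s[of i] \<open>1 \<le> k\<close> by auto
    have "int (elem_at C k) - int (elem_at C 1) \<le> int n - 1" if "card C = k"
    proof -
      have "finite C" using C by (rule finite_subset) simp
      then have "elem_at C k \<in> {1..n}" "elem_at C 1 \<in> {1..n}"
        using elem_at_in[of C] that \<open>1 \<le> k\<close> C by blast+
      then show ?thesis by auto
    qed
    then show ?thesis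
      using C gap \<open>s k = 1\<close> unfolding stable_subset_def by auto
  qed
  have "(\<exists>C\<subseteq>A. stable_subset n k s C) \<longleftrightarrow> has_stable \<sigma> k A" if "A \<subseteq> {1..n}" for A
  proof -
    have "finite A" using that by (rule finite_subset) simp
    then show ?thesis
      using has_stable_iff[of \<sigma> A k] \<sigma> subset that by (metis subset_trans)
  qed
  then show ?thesis
    unfolding stable_pairs_def stable_poset_def by auto
qed

lemma homotopy_equivalent_stable_poset_sphere:
  assumes \<sigma>: "\<And>i. 2 \<le> \<sigma> i" and n: "n = (\<Sum>l=1..j. \<sigma> l) + d + 2"
  shows "geometric_realization (order_complex (stable_poset \<sigma> (Suc j) n)) homotopy_equivalent_space nsphere d"
proof -
  let ?R = "suspension_rel \<sigma> (Suc j)" and ?P = "stable_poset \<sigma> (Suc j) n"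
  \<comment> \<open>The poset of stage \<open>m\<close> is empty, and \<open>n - m = d + 1\<close>
    counts the pairs of poles, hence the coordinate axes of the cross-polytope.\<close>
  define m where "m = Suc (\<Sum>l=1..j. \<sigma> l)"
  define a b :: "nat \<Rightarrow> (nat set \<times> nat set) + (bool \<times> nat)"
    where "a i = Inr (True, Suc m + i)" and "b i = Inr (False, Suc m + i)" for i
  have e1: "geometric_realization (order_complex ?P) homotopy_equivalent_space
      top_of_set (flag_real ?R (Inl ` ?P))"
    by (intro homeomorphic_imp_homotopy_equivalent_space geometric_realization_order_complex)
      (auto simp: finite_stable_poset)
  \<comment> \<open>With \<open>M = n\<close> there are no poles at the start.\<close>
  have e2: "top_of_set (flag_real ?R (Inl ` ?P)) homotopy_equivalent_space
      top_of_set (flag_real ?R (poles m n))"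
    using stable_poset_suspension[where \<sigma> = \<sigma>, OF \<sigma> m_def, of n n] n by (simp add: m_def poles_def)
  have e3: "poles m n = a ` {..d} \<union> b ` {..d}"
  proof -
    have "{m<..n} = (\<lambda>i. Suc m + i) ` {..d}"
      using image_add_atLeastAtMost[of "Suc m" 0 d] n by (auto simp: m_def atLeast0AtMost atLeastSucAtMost_greaterThanAtMost)
    then show ?thesis
      by (auto simp: poles_def a_def b_def UNIV_bool)
  qed
  have e4: "top_of_set (flag_real ?R (a ` {..d} \<union> b ` {..d})) homotopy_equivalent_space nsphere d"
    by (intro homeomorphic_imp_homotopy_equivalent_space flag_real_cross_polytope)
      (auto simp: a_def b_def inj_on_def)
  show ?thesis
    using homotopy_eqv_trans[OF homotopy_eqv_trans[OF e1 e2[unfolded e3]] e4] .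
qed

section \<open>Maps into spheres of higher dimension\<close>

lemma lipschitz_approximation:
  fixes F :: "'a::metric_space \<Rightarrow> real"
  assumes "compact K" "continuous_on K F" "0 < \<epsilon>"
  obtains G L where "L-lipschitz_on K G" "\<And>x. x \<in> K \<Longrightarrow> \<bar>G x - F x\<bar> \<le> \<epsilon>"
proof (cases "K = {}")
  case True
  then show ?thesis using that[of 0 F] by (auto simp: lipschitz_on_def)
next
  case False
  have "bounded (F ` K)"
    using assms(1,2) by (intro compact_imp_bounded compact_continuous_image)
  then obtain B where B: "\<And>x. x \<in> K \<Longrightarrow> \<bar>F x\<bar> \<le> B"
    by (auto simp: bounded_real)
  then have B0: "0 \<le> B" using False by fastforce
  have "uniformly_continuous_on K F"
    using assms by (intro compact_uniformly_continuous)
  then obtain \<delta> where \<delta>: "0 < \<delta>" "\<And>x y. x \<in> K \<Longrightarrow> y \<in> K \<Longrightarrow> dist y x < \<delta> \<Longrightarrow> \<bar>F y - F x\<bar> < \<epsilon>"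
    using \<open>0 < \<epsilon>\<close> unfolding uniformly_continuous_on_def dist_real_def by metis
  \<comment> \<open>With this slope a point at distance at least \<open>\<delta>\<close> costs
    \<open>2 * B\<close>, the largest possible variation of \<open>F\<close>, and cannot lower the
    infimum below \<open>F x\<close>; nearer points are controlled by uniform continuity.\<close>
  define L where "L = 2 * B / \<delta>"
  \<comment> \<open>Pasch--Hausdorff envelope\<close>
  define G where "G x = (INF y\<in>K. F y + L * dist x y)" for x
  have L: "0 \<le> L" using B0 \<delta>(1) by (simp add: L_def)
  have lower: "- B \<le> F y + L * dist x y" if "y \<in> K" for x y
    using B[OF that] L by (simp add: abs_le_iff add_increasing2)
  then have bdd: "bdd_below ((\<lambda>y. F y + L * dist x y) ` K)" for x
    by (intro bdd_belowI[of _ "- B"]) auto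
  have upper: "G x \<le> F y + L * dist x y" if "y \<in> K" for x y
    unfolding G_def using bdd that by (rule cINF_lower)
  have lip: "G x \<le> G y + L * dist x y" for x y
  proof -
    have "G x - L * dist x y \<le> F z + L * dist y z" if "z \<in> K" for z
    proof -
      have "L * dist x z \<le> L * (dist x y + dist y z)"
        using L by (intro mult_left_mono dist_triangle)
      then show ?thesis using upper[OF that, of x] by (simp add: algebra_simps)
    qed
    then have "G x - L * dist x y \<le> G y"
      unfolding G_def[of y] using False by (intro cINF_greatest) auto
    then show ?thesis by simp
  qed
  have "L-lipschitz_on K G"
  proof (rule lipschitz_onI)
    show "dist (G x) (G y) \<le> L * dist x y" for x y
      using lip[of x y] lip[of y x] by (auto simp: dist_real_def dist_commute)
  qed (fact L)
  moreover have "\<bar>G x - F x\<bar> \<le> \<epsilon>" if x: "x \<in> K" for x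
  proof -
    have "F x - \<epsilon> \<le> F y + L * dist x y" if y: "y \<in> K" for y
    proof (cases "dist x y < \<delta>")
      case True
      then have "F x - \<epsilon> \<le> F y" using \<delta>(2)[OF y x] by auto
      then show ?thesis using L by (simp add: add_increasing2)
    next
      case False
      then have "2 * B \<le> L * dist x y"
        using B0 \<delta>(1) by (simp add: L_def field_simps mult_left_mono)
      then show ?thesis using B[OF x] B[OF y] assms(3) by linarith
    qed
    then have "F x - \<epsilon> \<le> G x"
      unfolding G_def using False by (intro cINF_greatest) auto
    then show ?thesis using upper[OF x, of x] \<open>0 < \<epsilon>\<close> by auto
  qed
  ultimately show ?thesis by (rule that)
qed

text \<open>The metric on the function space weights the coordinate distances by powers of 1/2; the
  factor 2 is the sum of these weights.\<close>

lemma dist_fun_le: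
  fixes x y :: "nat \<Rightarrow> real"
  assumes "\<And>n. \<bar>x n - y n\<bar> \<le> r"
  shows "dist x y \<le> 2 * r"
proof -
  have g: "summable (\<lambda>n. (1/2)^n :: real)" by (simp add: summable_geometric)
  have "dist x y \<le> (\<Sum>n. (1/2)^n * r)"
    unfolding dist_fun_def
  proof (rule suminf_le)
    show "(1/2)^n * min (dist (x (from_nat n)) (y (from_nat n))) 1 \<le> (1/2)^n * r" for n
      using assms[of "from_nat n"] by (intro mult_left_mono) (auto simp: dist_real_def)
    show "summable (\<lambda>n. (1/2)^n * min (dist (x (from_nat n)) (y (from_nat n))) 1)"
      by (rule summable_comparison_test'[OF g]) auto
    show "summable (\<lambda>n. (1/2)^n * r)" using g by (rule summable_mult2)
  qed
  also have "\<dots> = (\<Sum>n. (1/2)^n) * r" using suminf_mult2[OF g, of r] by simp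
  also have "\<dots> = 2 * r" using suminf_geometric[of "1/2::real"] by simp
  finally show ?thesis .
qed

text \<open>A cube of dimension \<open>i + 1\<close> in the same function space as
  \<open>nsphere i\<close>. It serves as the ball bounded by the sphere, and its cells are easy to
  count.\<close>

definition box_upto :: "nat \<Rightarrow> (nat \<Rightarrow> real) set" where
  "box_upto i = {x. \<forall>l. if l \<le> i then \<bar>x l\<bar> \<le> 1 else x l = 0}"

lemma compact_box_upto: "compact (box_upto i)"
proof -
  have "box_upto i = (\<Pi>\<^sub>E l\<in>UNIV. if l \<le> i then {-1..1} else {0})"
    by (auto simp: box_upto_def PiE_def Pi_def abs_le_iff split: if_splits)
  then show ?thesis
    unfolding compactin_euclidean_iff[symmetric] euclidean_product_topology[symmetric]
    by (simp add: compactin_PiE)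
qed

text \<open>Otherwise every point of a grid of spacing \<open>\<eta> / M\<close> in a cube of
  dimension \<open>d + 1\<close> has a preimage. Preimages in a common cell of side
  \<open>1 / N\<close> have images closer than the spacing, so distinct grid points need distinct
  cells; but there are only about \<open>(2 * N) ^ (i + 1)\<close> cells.\<close>

lemma lipschitz_image_misses_point:
  fixes G :: "nat \<Rightarrow> (nat \<Rightarrow> real) \<Rightarrow> real"
  assumes "i < d" "0 < \<eta>" and lip: "\<And>j. j \<le> d \<Longrightarrow> L-lipschitz_on (box_upto i) (G j)"
  shows "\<exists>z. (\<forall>j\<le>d. 0 \<le> z j \<and> z j \<le> \<eta>) \<and> (\<forall>x\<in>box_upto i. \<exists>j\<le>d. G j x \<noteq> z j)"
proof (rule ccontr)
  assume neg: "\<not> ?thesis"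
  then have hit: "\<exists>x\<in>box_upto i. \<forall>j\<le>d. G j x = z j" if "\<forall>j\<le>d. 0 \<le> z j \<and> z j \<le> \<eta>" for z
    using that by blast
  have L: "0 \<le> L" using lip[of 0] by (auto simp: lipschitz_on_def)
  \<comment> \<open>With \<open>N = c * M\<close> this choice gives
    \<open>2 * L / N < \<eta> / M\<close>; here \<open>2 / N\<close> bounds the distance of two
    points in a cell.\<close>
  obtain c :: nat where c: "2 * L / \<eta> < real c" using reals_Archimedean2 by blast
  then have c0: "0 < c" using L assms(2) by (cases "c = 0") (auto simp: field_simps)
  \<comment> \<open>The cell count is at most \<open>(2 * c) ^ (i + 1) * (M + 1) ^ (i + 1)\<close>.
    Taking the first factor as \<open>M\<close> makes this smaller than
    \<open>(M + 1) ^ (i + 2)\<close>, hence than the grid count.\<close>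
  define M where "M = (2 * c) ^ (i + 1)"
  define N where "N = c * M"
  have M0: "0 < M" using c0 by (simp add: M_def)
  have N0: "0 < N" using c0 M0 by (simp add: N_def)
  let ?grid = "{..d} \<rightarrow>\<^sub>E {..M}"
  let ?cells = "{..i} \<rightarrow>\<^sub>E {- int N..int N}"
  have "\<exists>x\<in>box_upto i. \<forall>j\<le>d. G j x = \<eta> * real (\<alpha> j) / real M" if "\<alpha> \<in> ?grid" for \<alpha>
  proof -
    have "real (\<alpha> j) / real M \<le> 1" if "j \<le> d" for j
      using \<open>\<alpha> \<in> ?grid\<close> that M0 by (auto simp: PiE_def Pi_def)
    then have "\<eta> * (real (\<alpha> j) / real M) \<le> \<eta> * 1" if "j \<le> d" for j
      using that assms(2) by (intro mult_left_mono) auto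
    then have "\<forall>j\<le>d. 0 \<le> \<eta> * real (\<alpha> j) / real M \<and> \<eta> * real (\<alpha> j) / real M \<le> \<eta>"
      using assms(2) by simp
    then show ?thesis by (rule hit)
  qed
  then have "\<forall>\<alpha>\<in>?grid. \<exists>x. x \<in> box_upto i \<and> (\<forall>j\<le>d. G j x = \<eta> * real (\<alpha> j) / real M)"
    by blast
  from bchoice[OF this] obtain w where w: "\<And>\<alpha>. \<alpha> \<in> ?grid \<Longrightarrow> w \<alpha> \<in> box_upto i"
    "\<And>\<alpha> j. \<alpha> \<in> ?grid \<Longrightarrow> j \<le> d \<Longrightarrow> G j (w \<alpha>) = \<eta> * real (\<alpha> j) / real M"
    by blast
  define cell where "cell \<alpha> = (\<lambda>l\<in>{..i}. \<lfloor>real N * w \<alpha> l\<rfloor>)" for \<alpha>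
  have "inj_on cell ?grid"
  proof (rule inj_onI)
    fix \<alpha> \<beta> assume \<alpha>: "\<alpha> \<in> ?grid" and \<beta>: "\<beta> \<in> ?grid" and eq: "cell \<alpha> = cell \<beta>"
    have "\<bar>w \<alpha> l - w \<beta> l\<bar> \<le> 1 / real N" for l
    proof (cases "l \<le> i")
      case True
      then have "\<lfloor>real N * w \<alpha> l\<rfloor> = \<lfloor>real N * w \<beta> l\<rfloor>"
        using fun_cong[OF eq, of l] by (simp add: cell_def)
      then have "\<bar>real N * w \<alpha> l - real N * w \<beta> l\<bar> \<le> 1"
        by linarith
      then have "real N * \<bar>w \<alpha> l - w \<beta> l\<bar> \<le> 1"
        by (simp add: abs_mult flip: right_diff_distrib)
      then show ?thesis using N0 by (simp add: field_simps)
    next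
      case False
      then show ?thesis using w(1)[OF \<alpha>] w(1)[OF \<beta>] by (auto simp: box_upto_def)
    qed
    then have dist: "dist (w \<alpha>) (w \<beta>) \<le> 2 * (1 / real N)" by (rule dist_fun_le)
    have "\<alpha> j = \<beta> j" if j: "j \<le> d" for j
    proof -
      have "\<bar>\<eta> * real (\<alpha> j) / real M - \<eta> * real (\<beta> j) / real M\<bar> \<le> L * dist (w \<alpha>) (w \<beta>)"
        using lipschitz_onD[OF lip[OF j] w(1)[OF \<alpha>] w(1)[OF \<beta>]] w(2)[OF \<alpha> j] w(2)[OF \<beta> j]
        by (simp add: dist_real_def)
      also have "\<dots> \<le> L * (2 * (1 / real N))"
        using dist L by (rule mult_left_mono)
      also have "\<dots> < \<eta> / real M"
        using c c0 M0 assms(2) by (simp add: N_def field_simps)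
      finally have lt: "\<bar>\<eta> * real (\<alpha> j) / real M - \<eta> * real (\<beta> j) / real M\<bar> < \<eta> / real M" .
      have u: "0 < \<eta> / real M" using assms(2) M0 by simp
      have "\<eta> * real (\<alpha> j) / real M - \<eta> * real (\<beta> j) / real M = \<eta> / real M * (real (\<alpha> j) - real (\<beta> j))"
        by (simp add: right_diff_distrib)
      with lt u have "\<eta> / real M * \<bar>real (\<alpha> j) - real (\<beta> j)\<bar> < \<eta> / real M * 1"
        by (simp only: abs_mult abs_of_pos mult_1_right)
      then have "\<bar>real (\<alpha> j) - real (\<beta> j)\<bar> < 1"
        unfolding mult_less_cancel_left_pos[OF u] .
      then show ?thesis by linarith
    qed
    then show "\<alpha> = \<beta>"
      using \<alpha> \<beta> by (intro PiE_ext[of _ "{..d}" "\<lambda>_. {..M}"]) auto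
  qed
  moreover have "cell ` ?grid \<subseteq> ?cells"
  proof -
    have "\<lfloor>real N * w \<alpha> l\<rfloor> \<in> {- int N..int N}" if "\<alpha> \<in> ?grid" "l \<le> i" for \<alpha> l
    proof -
      have "\<bar>w \<alpha> l\<bar> \<le> 1" using w(1)[OF that(1)] that(2) by (auto simp: box_upto_def)
      then have "\<bar>real N * w \<alpha> l\<bar> \<le> real N * 1"
        unfolding abs_mult by (intro mult_mono) auto
      then show ?thesis by (auto simp: abs_le_iff le_floor_iff floor_le_iff)
    qed
    then have "cell \<alpha> \<in> ?cells" if "\<alpha> \<in> ?grid" for \<alpha>
      using that unfolding cell_def by (intro restrict_PiE_iff[THEN iffD2]) blast
    then show ?thesis by blast
  qed
  ultimately have "card ?grid \<le> card ?cells"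
    by (intro card_inj_on_le) (auto intro: finite_PiE)
  then have "(M + 1) ^ (d + 1) \<le> (2 * N + 1) ^ (i + 1)"
    by (simp add: card_PiE nat_add_distrib nat_mult_distrib)
  also have "\<dots> \<le> (2 * c * (M + 1)) ^ (i + 1)"
    using c0 by (intro power_mono) (auto simp: N_def algebra_simps)
  also have "\<dots> = M * (M + 1) ^ (i + 1)"
    unfolding M_def by (rule power_mult_distrib)
  also have "\<dots> < (M + 1) ^ (i + 2)"
    by simp
  also have "\<dots> \<le> (M + 1) ^ (d + 1)"
    using assms(1) by (intro power_increasing) auto
  finally show False by simp
qed

lemma nsphere_eq: "nsphere d = top_of_set {x. (\<Sum>i\<le>d. (x i)\<^sup>2) = 1 \<and> (\<forall>i>d. x i = 0)}"
  by (simp add: nsphere euclidean_product_topology)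

text \<open>The coordinates of \<open>f\<close> extend over the cube by the Tietze theorem. A
  Lipschitz approximation shifted by a missed point \<open>z\<close> gives \<open>H\<close>, which
  avoids the origin on the whole cube. Inside \<open>Q\<close>, the nonzero vectors,
  \<open>f\<close> is homotopic to \<open>H\<close>, and \<open>H\<close> to a constant; the radial
  projection \<open>nrm\<close> returns to the sphere.\<close>

lemma nullhomotopic_nsphere:
  assumes f: "continuous_map (nsphere i) (nsphere d) f" and "i < d"
  shows "\<exists>c. homotopic_with (\<lambda>_. True) (nsphere i) (nsphere d) f (\<lambda>_. c)"
proof -
  let ?S = "\<lambda>d. {x. (\<Sum>i\<le>d. (x i)\<^sup>2) = 1 \<and> (\<forall>i>d. x i = (0::real))}"
  define Q where "Q = {y :: nat \<Rightarrow> real. (\<forall>j>d. y j = 0) \<and> (\<exists>j\<le>d. y j \<noteq> 0)}"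
  define nrm where "nrm y = (\<lambda>j. y j / sqrt (\<Sum>j\<le>d. (y j)\<^sup>2))" for y :: "nat \<Rightarrow> real"
  \<comment> \<open>Approximation and shift together move each coordinate by at most
    \<open>2 * \<epsilon>\<close>. The constant keeps the sum of \<open>d + 1\<close> squares of
    this size below 1.\<close>
  define \<epsilon> where "\<epsilon> = 1 / (4 * (real d + 1))"
  have \<epsilon>: "0 < \<epsilon>" by (simp add: \<epsilon>_def)
  have sub: "?S i \<subseteq> box_upto i"
  proof
    fix x assume x: "x \<in> ?S i"
    have "(x l)\<^sup>2 \<le> 1" if "l \<le> i" for l
      using x that member_le_sum[of l "{..i}" "\<lambda>l. (x l)\<^sup>2"] by auto
    then show "x \<in> box_upto i"
      using x by (auto simp: box_upto_def abs_square_le_1)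
  qed
  have coord: "continuous_on X (\<lambda>x. x l)" for X :: "(nat \<Rightarrow> real) set" and l
    by (auto intro: continuous_on_subset[OF continuous_on_product_coordinates])
  have cf: "continuous_on (?S i) f" "f \<in> ?S i \<rightarrow> ?S d"
    using f by (auto simp: nsphere_eq)
  have clS: "closed (?S i)"
  proof -
    have "closed {x :: nat \<Rightarrow> real. (\<Sum>l\<le>i. (x l)\<^sup>2) = 1}"
      by (intro closed_Collect_eq continuous_intros coord)
    moreover have "closed {x :: nat \<Rightarrow> real. \<forall>l. i < l \<longrightarrow> x l = 0}"
      by (intro closed_Collect_all closed_Collect_imp closed_Collect_eq continuous_intros coord) auto
    ultimately show ?thesis by (auto simp: Collect_conj_eq)
  qed
  have "\<exists>F. continuous_on (box_upto i) F \<and> (\<forall>x\<in>?S i. F x = f x j)" for j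
  proof -
    have "continuous_on (?S i) (\<lambda>x. f x j)"
      using cf(1) by (rule continuous_on_product_then_coordinatewise)
    moreover have "closedin (top_of_set (box_upto i)) (?S i)"
      using clS sub by (rule closed_subset[rotated])
    ultimately show ?thesis
      by (rule Tietze_unbounded) blast
  qed
  then obtain F where "\<forall>j. continuous_on (box_upto i) (F j) \<and> (\<forall>x\<in>?S i. F j x = f x j)"
    using choice[of "\<lambda>j F. continuous_on (box_upto i) F \<and> (\<forall>x\<in>?S i. F x = f x j)"] by blast
  then have F: "\<And>j. continuous_on (box_upto i) (F j)" "\<And>j x. x \<in> ?S i \<Longrightarrow> F j x = f x j"
    by blast+
  have "\<exists>G L. L-lipschitz_on (box_upto i) G \<and> (\<forall>x\<in>box_upto i. \<bar>G x - F j x\<bar> \<le> \<epsilon>)" for j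
    by (rule lipschitz_approximation[OF compact_box_upto F(1) \<epsilon>]) blast
  then obtain G where "\<forall>j. \<exists>L. L-lipschitz_on (box_upto i) (G j) \<and> (\<forall>x\<in>box_upto i. \<bar>G j x - F j x\<bar> \<le> \<epsilon>)"
    using choice[of "\<lambda>j G. \<exists>L. L-lipschitz_on (box_upto i) G \<and> (\<forall>x\<in>box_upto i. \<bar>G x - F j x\<bar> \<le> \<epsilon>)"] by blast
  then obtain L where "\<forall>j. (L j)-lipschitz_on (box_upto i) (G j) \<and> (\<forall>x\<in>box_upto i. \<bar>G j x - F j x\<bar> \<le> \<epsilon>)"
    using choice[of "\<lambda>j L. L-lipschitz_on (box_upto i) (G j) \<and> (\<forall>x\<in>box_upto i. \<bar>G j x - F j x\<bar> \<le> \<epsilon>)"] by blast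
  then have G: "\<And>j. (L j)-lipschitz_on (box_upto i) (G j)"
    "\<And>j x. x \<in> box_upto i \<Longrightarrow> \<bar>G j x - F j x\<bar> \<le> \<epsilon>"
    by blast+
  have lip: "(\<Sum>j\<le>d. L j)-lipschitz_on (box_upto i) (G j)" if "j \<le> d" for j
  proof (rule lipschitz_on_le[OF G(1)])
    show "L j \<le> (\<Sum>j\<le>d. L j)"
      using that lipschitz_on_nonneg[OF G(1)] by (intro member_le_sum) auto
  qed
  obtain z where z: "\<forall>j\<le>d. 0 \<le> z j \<and> z j \<le> \<epsilon>"
    "\<forall>x\<in>box_upto i. \<exists>j\<le>d. G j x \<noteq> z j"
    using lipschitz_image_misses_point[where G = G, OF \<open>i < d\<close> \<epsilon> lip] by auto
  define H where "H x = (\<lambda>j. if j \<le> d then G j x - z j else 0)" for x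
  have "continuous_on (box_upto i) (\<lambda>x. H x j)" for j
    using lipschitz_on_continuous_on[OF G(1)[of j]] by (cases "j \<le> d") (auto simp: H_def intro!: continuous_intros)
  then have cH: "continuous_on (box_upto i) H"
    by (rule continuous_on_coordinatewise_then_product)
  have HQ: "H x \<in> Q" if "x \<in> box_upto i" for x
    using bspec[OF z(2) that] by (auto simp: H_def Q_def)
  have near: "\<bar>f x j - H x j\<bar> \<le> 2 * \<epsilon>" if "x \<in> ?S i" "j \<le> d" for x j
    using G(2)[of x j] F(2)[OF that(1), of j] z(1)[rule_format, OF that(2)] that sub by (auto simp: H_def abs_le_iff)
  have h1: "homotopic_with_canon (\<lambda>_. True) (?S i) Q f H"
  proof (rule homotopic_with_segments)
    fix x and t :: real assume x: "x \<in> ?S i" and t: "0 \<le> t" "t \<le> 1"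
    have fx: "(\<Sum>j\<le>d. (f x j)\<^sup>2) = 1" "\<forall>j>d. f x j = 0"
      using cf(2) x by auto
    \<comment> \<open>If the segment met the origin, all coordinates of \<open>f x\<close> would be
      bounded by \<open>2 * \<epsilon>\<close>, too small for a point of the sphere.\<close>
    have "\<exists>j\<le>d. (1 - t) * f x j + t * H x j \<noteq> 0"
    proof (rule ccontr)
      assume "\<not> ?thesis"
      then have diff: "f x j = t * (f x j - H x j)" if "j \<le> d" for j
        using that by (auto simp: algebra_simps)
      have "\<bar>f x j\<bar> \<le> 2 * \<epsilon>" if "j \<le> d" for j
      proof -
        have "\<bar>f x j\<bar> = t * \<bar>f x j - H x j\<bar>"
          using diff[OF that] t by (metis abs_mult abs_of_nonneg)
        also have "\<dots> \<le> \<bar>f x j - H x j\<bar>"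
          using t by (intro mult_left_le_one_le) auto
        also have "\<dots> \<le> 2 * \<epsilon>" by (rule near[OF x that])
        finally show ?thesis .
      qed
      then have "(f x j)\<^sup>2 \<le> (2 * \<epsilon>)\<^sup>2" if "j \<le> d" for j
        using power_mono[of "\<bar>f x j\<bar>" "2 * \<epsilon>" 2] that by simp
      then have "(\<Sum>j\<le>d. (f x j)\<^sup>2) \<le> (\<Sum>j\<le>d. (2 * \<epsilon>)\<^sup>2)"
        by (intro sum_mono) auto
      also have "\<dots> = ((real d + 1) * (2 * \<epsilon>)) * (2 * \<epsilon>)"
        by (simp add: power2_eq_square algebra_simps)
      also have "(real d + 1) * (2 * \<epsilon>) = 1 / 2"
        by (simp add: \<epsilon>_def)
      also have "1 / 2 * (2 * \<epsilon>) < 1"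
        by (simp add: \<epsilon>_def)
      finally show False using fx by simp
    qed
    then show "(\<lambda>v. (1 - t) * f x v + t * H x v) \<in> Q"
      using fx by (auto simp: Q_def H_def)
  qed (use cf cH sub in \<open>auto intro: continuous_on_subset\<close>)
  \<comment> \<open>The sphere contracts to the origin within the cube; composing with
    \<open>H\<close> carries this contraction into \<open>Q\<close>.\<close>
  have "homotopic_with_canon (\<lambda>_. True) (?S i) (box_upto i) id (\<lambda>_ _. 0)"
  proof (rule homotopic_with_segments)
    fix x and t :: real assume x: "x \<in> ?S i" and t: "0 \<le> t" "t \<le> 1"
    then have "x \<in> box_upto i" using sub by blast
    moreover have "\<bar>(1 - t) * y\<bar> \<le> 1" if "\<bar>y\<bar> \<le> 1" for y
      using that t by (simp add: abs_mult mult_le_one)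
    ultimately show "(\<lambda>v. (1 - t) * id x v + t * 0) \<in> box_upto i"
      by (auto simp: box_upto_def split: if_splits)
  qed auto
  then have "homotopic_with_canon (\<lambda>_. True) (?S i) Q (H \<circ> id) (H \<circ> (\<lambda>_ _. 0))"
    by (rule homotopic_with_compose_continuous_map_left) (use cH HQ in auto)
  then have "homotopic_with_canon (\<lambda>_. True) (?S i) Q f (H \<circ> (\<lambda>_ _. 0))"
    using homotopic_with_trans[OF h1] by simp
  moreover have "continuous_map (top_of_set Q) (top_of_set (?S d)) nrm"
  proof -
    have pos: "0 < (\<Sum>j\<le>d. (y j)\<^sup>2)" if "y \<in> Q" for y
    proof -
      have "\<exists>j\<le>d. y j \<noteq> 0" using that by (simp add: Q_def)
      then obtain j where "j \<le> d" "y j \<noteq> 0" by (elim exE conjE)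
      then show ?thesis by - (rule sum_pos2[of _ j], auto)
    qed
    have "sqrt (\<Sum>j\<le>d. (y j)\<^sup>2) \<noteq> 0" if "y \<in> Q" for y
      using pos[OF that] by simp
    then have "continuous_on Q (\<lambda>y. nrm y j)" for j
      unfolding nrm_def by (intro continuous_intros coord ballI)
    then have "continuous_on Q nrm"
      by (rule continuous_on_coordinatewise_then_product)
    moreover have "nrm y \<in> ?S d" if "y \<in> Q" for y
    proof -
      have "(\<Sum>j\<le>d. (nrm y j)\<^sup>2) = (\<Sum>j\<le>d. (y j)\<^sup>2) / (\<Sum>j\<le>d. (y j)\<^sup>2)"
        using pos[OF that] by (simp add: nrm_def power_divide flip: sum_divide_distrib)
      then show ?thesis using pos[OF that] that by (simp add: nrm_def Q_def)
    qed
    ultimately show ?thesis by auto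
  qed
  ultimately have "homotopic_with (\<lambda>_. True) (nsphere i) (nsphere d) (nrm \<circ> f) (nrm \<circ> (H \<circ> (\<lambda>_ _. 0)))"
    unfolding nsphere_eq by (rule homotopic_with_compose_continuous_map_left) auto
  then have "homotopic_with (\<lambda>_. True) (nsphere i) (nsphere d) f (nrm \<circ> (H \<circ> (\<lambda>_ _. 0)))"
  proof (rule homotopic_with_eq)
    fix x assume "x \<in> topspace (nsphere i)"
    then have "f x \<in> ?S d" using cf(2) by (auto simp: nsphere_eq)
    then show "f x = (nrm \<circ> f) x" by (auto simp: nrm_def)
  qed auto
  then show ?thesis by (auto simp: o_def)
qed

text \<open>A map from a smaller sphere is sent to \<open>nsphere d\<close> by \<open>g\<close>,
  contracted there, and brought back by \<open>h\<close>; as \<open>h \<circ> g\<close> is homotopic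
  to the identity, the original map is null-homotopic too.\<close>

lemma connected_upto_homotopy_sphere:
  assumes "X homotopy_equivalent_space nsphere d"
  shows "connected_upto (int d - 1) X"
proof -
  obtain g h where g: "continuous_map X (nsphere d) g" and h: "continuous_map (nsphere d) X h"
    and hg: "homotopic_with (\<lambda>x. True) X X (h \<circ> g) id"
    using assms unfolding homotopy_equivalent_space_def by blast
  have "topspace X \<noteq> {}"
    using h in_topspace_nsphere[of d] unfolding continuous_map_def by blast
  moreover have "\<exists>c. homotopic_with (\<lambda>_. True) (nsphere i) X f (\<lambda>_. c)"
    if "i < d" and f: "continuous_map (nsphere i) X f" for i f
  proof -
    obtain c where c: "homotopic_with (\<lambda>_. True) (nsphere i) (nsphere d) (g \<circ> f) (\<lambda>_. c)"
      using nullhomotopic_nsphere[OF continuous_map_compose[OF f g] \<open>i < d\<close>] by blast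
    have "homotopic_with (\<lambda>_. True) (nsphere i) X (h \<circ> (g \<circ> f)) (h \<circ> (\<lambda>_. c))"
      using c h by (rule homotopic_with_compose_continuous_map_left) auto
    moreover have "homotopic_with (\<lambda>_. True) (nsphere i) X ((h \<circ> g) \<circ> f) (id \<circ> f)"
      using hg f by (rule homotopic_with_compose_continuous_map_right) auto
    ultimately have "homotopic_with (\<lambda>_. True) (nsphere i) X f (h \<circ> (\<lambda>_. c))"
      using homotopic_with_trans homotopic_with_symD by (fastforce simp: o_assoc)
    then show ?thesis by (auto simp: o_def)
  qed
  ultimately show ?thesis
    unfolding connected_upto_def by auto
qed

theorem theorem7:
  fixes n k :: nat and s :: "nat \<Rightarrow> int"
  assumes "2 \<le> k"
    and "\<forall>i\<in>{1..k-1}. 2 \<le> s i"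
    and "s k = 1"
    and "int n \<ge> (\<Sum>i=1..k-1. s i) + 2"
  shows "geometric_realization (order_complex (stable_pairs n k s))
           homotopy_equivalent_space nsphere (nat (int n - (\<Sum>i=1..k-1. s i) - 2))
       \<and> connected_upto (int n - (\<Sum>i=1..k-1. s i) - 3)
           (geometric_realization (order_complex (stable_pairs n k s)))"
proof -
  \<comment> \<open>The value 2 outside the index range makes the bound
    \<open>2 \<le> \<sigma> i\<close>, required for all \<open>i\<close> by the lemmas above, hold
    everywhere.\<close>
  define \<sigma> where "\<sigma> i = (if i \<in> {1..k-1} then nat (s i) else 2)" for i
  define d where "d = nat (int n - (\<Sum>i=1..k-1. s i) - 2)"
  have s: "s i = int (\<sigma> i)" and "2 \<le> \<sigma> i" if "i \<in> {1..k-1}" for i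
    using bspec[OF assms(2) that] that unfolding \<sigma>_def by simp_all
  then have \<sigma>: "2 \<le> \<sigma> i" for i
    by (cases "i \<in> {1..k-1}") (auto simp: \<sigma>_def)
  have sum: "(\<Sum>i=1..k-1. s i) = int (\<Sum>i=1..k-1. \<sigma> i)"
    unfolding of_nat_sum by (rule sum.cong) (use s in auto)
  have d: "n = (\<Sum>i=1..k-1. \<sigma> i) + d + 2" "int d = int n - (\<Sum>i=1..k-1. s i) - 2"
    using assms(4) sum unfolding d_def by linarith+
  have "stable_pairs n k s = stable_poset \<sigma> k n"
  proof (rule stable_pairs_eq)
    show "1 \<le> \<sigma> i" for i using \<sigma>[of i] by simp
  qed (use s assms in auto)
  moreover have "k = Suc (k - 1)" using assms(1) by simp
  ultimately have eq: "geometric_realization (order_complex (stable_pairs n k s)) homotopy_equivalent_space nsphere d"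
    using homotopy_equivalent_stable_poset_sphere[of \<sigma>, OF \<sigma> d(1)] by simp
  have "connected_upto (int d - 1) (geometric_realization (order_complex (stable_pairs n k s)))"
    using eq by (rule connected_upto_homotopy_sphere)
  moreover have "int d - 1 = int n - (\<Sum>i=1..k-1. s i) - 3"
    using d(2) by simp
  ultimately show ?thesis
    using eq unfolding d_def[symmetric] by simp
qed

end
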